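(* Any algorithm $\mathcal{A}$ for the $\mathsf{LOCAL}$ model taking time $T$ and energy $E$ can be simulated (with high probability) in the randomized $\mathsf{No}\text{-}\mathsf{CD}$ model using $O(\Delta^2 T+\Delta\log\Delta\log n)$ time and $O(\Delta(E+\log\Delta\log n))$ energy. This holds even when $\mathcal{A}$ is full-duplex (vertices may transmit and listen in the same slot), while in the simulation simultaneous transmission and reception are not allowed.
   Context: Radio network model: the network is a connected undirected graph $G=(V,E)$ with $n=|V|$ and maximum degree $\Delta$, both known to all vertices. Time is divided into synchronized slots; in each slot a vertex transmits, listens, or is idle. Transmitting or listening costs one unit of energy, idling is free; time is the number of slots and energy the maximum over vertices of the number of transmit/listen slots. In $\mathsf{LOCAL}$, a listener receives every message sent by its neighbors in that slot. In $\mathsf{No}\text{-}\mathsf{CD}$, a listener receives a message only if exactly one neighbor transmits; otherwise it hears silence. Randomized algorithms have private random bits; "with high probability" means failure probability at most $1/\mathrm{poly}(n)$. *)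

theory Defs
  imports Complex_Main "HOL-Library.Multiset"
begin

definition is_graph :: "'v set \<Rightarrow> ('v \<Rightarrow> 'v \<Rightarrow> bool) \<Rightarrow> bool" where
  "is_graph V E \<longleftrightarrow> finite V \<and> V \<noteq> {} \<and>
     (\<forall>u v. E u v \<longrightarrow> u \<in> V \<and> v \<in> V \<and> u \<noteq> v \<and> E v u) \<and>
     (\<forall>u\<in>V. \<forall>v\<in>V. E\<^sup>*\<^sup>* u v)"

definition max_deg :: "'v set \<Rightarrow> ('v \<Rightarrow> 'v \<Rightarrow> bool) \<Rightarrow> nat" where
  "max_deg V E = Max ((\<lambda>v. card {u. E v u}) ` V)"

text \<open>LOCAL model (full duplex allowed). An algorithm is given by an action
  function act t s = (message transmitted or None, listening?) and an update
  function upd t s R, where R is the multiset of all messages received in slot t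
  (empty if not listening). The input of vertex v is its initial state x v
  (which may contain its ID and its random bits).\<close>

fun local_run :: "('v \<Rightarrow> 'v \<Rightarrow> bool) \<Rightarrow> (nat \<Rightarrow> 's \<Rightarrow> 'm option \<times> bool)
     \<Rightarrow> (nat \<Rightarrow> 's \<Rightarrow> 'm multiset \<Rightarrow> 's) \<Rightarrow> ('v \<Rightarrow> 's) \<Rightarrow> nat \<Rightarrow> 'v \<Rightarrow> 's" where
  "local_run E act upd x 0 = x"
| "local_run E act upd x (Suc t) =
     (\<lambda>v. let st = local_run E act upd x t in
        upd t (st v)
          (if snd (act t (st v))
           then image_mset (\<lambda>u. the (fst (act t (st u))))
                  (mset_set {u. E v u \<and> fst (act t (st u)) \<noteq> None})
           else {#}))"

definition local_energy :: "('v \<Rightarrow> 'v \<Rightarrow> bool) \<Rightarrow> (nat \<Rightarrow> 's \<Rightarrow> 'm option \<times> bool)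
     \<Rightarrow> (nat \<Rightarrow> 's \<Rightarrow> 'm multiset \<Rightarrow> 's) \<Rightarrow> ('v \<Rightarrow> 's) \<Rightarrow> nat \<Rightarrow> 'v \<Rightarrow> nat" where
  "local_energy E act upd x T v =
     card {t. t < T \<and> (let a = act t (local_run E act upd x t v) in fst a \<noteq> None \<or> snd a)}"

text \<open>No-CD model (half duplex): in each slot a vertex is idle, transmits, or
  listens. A randomized No-CD algorithm is given by a decision function which maps
  the local input, the vertex's private random bits and its history of receptions
  (one entry per past slot: Some m if it listened and exactly one neighbour
  transmitted, None otherwise) to the action in the current slot, and an output
  function of the same local view.\<close>

datatype 'm actB = BIdle | BTransmit 'm | BListen

fun nocd_hist :: "('v \<Rightarrow> 'v \<Rightarrow> bool) \<Rightarrow> ('s \<Rightarrow> bool list \<Rightarrow> 'mb option list \<Rightarrow> 'mb actB)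
     \<Rightarrow> ('v \<Rightarrow> 's) \<Rightarrow> ('v \<Rightarrow> bool list) \<Rightarrow> nat \<Rightarrow> 'v \<Rightarrow> 'mb option list" where
  "nocd_hist E b x r 0 = (\<lambda>v. [])"
| "nocd_hist E b x r (Suc t) =
     (\<lambda>v. let h = nocd_hist E b x r t; a = (\<lambda>u. b (x u) (r u) (h u)) in
        h v @ [if a v = BListen \<and> (\<exists>!u. E v u \<and> (\<exists>m. a u = BTransmit m))
               then Some (THE m. \<exists>u. E v u \<and> a u = BTransmit m)
               else None])"

definition nocd_energy :: "('v \<Rightarrow> 'v \<Rightarrow> bool) \<Rightarrow> ('s \<Rightarrow> bool list \<Rightarrow> 'mb option list \<Rightarrow> 'mb actB)
     \<Rightarrow> ('v \<Rightarrow> 's) \<Rightarrow> ('v \<Rightarrow> bool list) \<Rightarrow> nat \<Rightarrow> 'v \<Rightarrow> nat" where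
  "nocd_energy E b x r T v =
     card {t. t < T \<and> b (x v) (r v) (nocd_hist E b x r t v) \<noteq> BIdle}"

text \<open>Private random bits: each vertex of V gets L uniformly random bits;
  the probability space is the uniform distribution on this finite set.\<close>

definition rand_assign :: "'v set \<Rightarrow> nat \<Rightarrow> ('v \<Rightarrow> bool list) set" where
  "rand_assign V L = {r. (\<forall>v\<in>V. length (r v) = L) \<and> (\<forall>v. v \<notin> V \<longrightarrow> r v = [])}"

text \<open>Messages of the simulating No-CD algorithm: lists of LOCAL messages plus
  a list of natural numbers (control information).\<close>

type_synonym 'm sim_msg = "'m list \<times> nat list"

end

theory Submission
  imports Defs "HOL-Library.FuncSet" "HOL-Library.Countable"
begin

text \<open>
  Given a colouring with \<open>O(\<Delta>\<^sup>2)\<close> colours in which vertices at distance at most two differ, a LOCAL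
  slot is simulated by one slot per colour: an active vertex transmits in the slot of its own colour
  and listens in the slots of its neighbours' colours, at most \<open>\<Delta> + 1\<close> slots in total.

  The colouring is computed by slots in which every vertex transmits with probability about \<open>1 / \<Delta>\<close>,
  so that a given neighbour is heard with probability at least \<open>1 / (8 * \<Delta>)\<close>. After
  \<open>O(\<Delta> log \<Delta> log n)\<close> such slots all vertices know the random identifiers of their neighbours. Then come \<open>O(log n)\<close>
  phases of \<open>O(\<Delta> log \<Delta>)\<close> slots, in each of which an uncoloured vertex tries a random colour. Knowing
  its neighbours, a vertex can tell whether it has heard all of them, so a colour is only ever
  accepted when it is certain to be free of conflicts; and given any past, a phase succeeds for a
  fixed vertex with probability at least \<open>1 / 2\<close>, as it is enough that the vertex and its
  neighbours hear all their neighbours (which fails with probability \<open>1 / poly(\<Delta>)\<close>) and that the random colour is free.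
\<close>

text \<open>The obstacle is a logarithmic factor. If every phase delivered all its messages with
  high probability, it would take about \<open>\<Delta> * log n\<close> slots, and
  \<open>O(log n)\<close> such phases would exceed the bound. Phases are therefore kept so short
  that a message is lost with probability polynomially small in \<open>\<Delta>\<close> only; with
  many vertices some losses are to be expected in every phase, and the protocol has to turn a loss
  into a delay instead of a wrong colour. The analysis rests on transmissions being oblivious: the
  coins alone decide who sends in which setup slot, the past influences only the contents. Reception
  events of different slots thus depend on disjoint sets of tokens, and the candidates of a phase
  are independent of all that happened before it. Conditional probabilities become averages over
  some of the tokens that are bounded for every value of the others. Energy needs no separate care
  during the setup, whose entire length fits into the additive term of the energy bound.\<close>

section \<open>Averages over random tokens\<close>

text \<open>This is the conditional expectation of \<open>f\<close> given the coordinates outside of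
  \<open>J\<close>, for independent tokens uniform in \<open>{..<M}\<close>. Keeping it a function
  of the whole assignment \<open>\<tau>\<close> lets averages over disjoint sets of coordinates be
  nested.\<close>

definition avg :: "nat \<Rightarrow> 'i set \<Rightarrow> (('i \<Rightarrow> nat) \<Rightarrow> real) \<Rightarrow> ('i \<Rightarrow> nat) \<Rightarrow> real" where
  "avg M J f \<tau> = (\<Sum>\<sigma>\<in>J \<rightarrow>\<^sub>E {..<M}. f (override_on \<tau> \<sigma> J)) / real M ^ card J"

text \<open>The counterpart of being measurable with respect to the coordinates outside of
  \<open>J\<close>.\<close>

definition unaffected :: "'i set \<Rightarrow> (('i \<Rightarrow> 'b) \<Rightarrow> 'c) \<Rightarrow> bool" where
  "unaffected J f \<longleftrightarrow> (\<forall>\<tau> \<tau>'. (\<forall>i. i \<notin> J \<longrightarrow> \<tau> i = \<tau>' i) \<longrightarrow> f \<tau> = f \<tau>')"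

lemma avg_empty [simp]: "avg M {} f \<tau> = f \<tau>"
  by (simp add: avg_def)

lemma avg_insert:
  assumes "finite J" "i \<notin> J"
  shows "avg M (insert i J) f \<tau> = (\<Sum>a<M. avg M J f (\<tau>(i := a))) / real M"
proof -
  have inj: "inj_on (\<lambda>(y, g). g(i := y)) ({..<M} \<times> (J \<rightarrow>\<^sub>E {..<M}))"
    using inj_combinator[OF assms(2), of "\<lambda>_. {..<M}"] by simp
  have ov: "override_on \<tau> (\<sigma>(i := a)) (insert i J) = override_on (\<tau>(i := a)) \<sigma> J" for \<sigma> a
    using assms(2) by (auto simp: override_on_def fun_eq_iff)
  have "(\<Sum>\<sigma>\<in>insert i J \<rightarrow>\<^sub>E {..<M}. f (override_on \<tau> \<sigma> (insert i J)))
      = (\<Sum>(a, \<sigma>)\<in>{..<M} \<times> (J \<rightarrow>\<^sub>E {..<M}). f (override_on (\<tau>(i := a)) \<sigma> J))"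
    unfolding PiE_insert_eq by (subst sum.reindex[OF inj]) (simp add: case_prod_beta ov)
  also have "\<dots> = (\<Sum>a<M. \<Sum>\<sigma>\<in>J \<rightarrow>\<^sub>E {..<M}. f (override_on (\<tau>(i := a)) \<sigma> J))"
    by (simp add: sum.cartesian_product)
  finally show ?thesis
    using assms by (simp add: avg_def sum_divide_distrib mult.commute)
qed

lemma avg_singleton: "avg M {i} f \<tau> = (\<Sum>a<M. f (\<tau>(i := a))) / real M"
  by (simp add: avg_insert)

lemma avg_mono: "(\<And>\<tau>. f \<tau> \<le> g \<tau>) \<Longrightarrow> avg M J f \<tau> \<le> avg M J g \<tau>"
  unfolding avg_def by (intro divide_right_mono sum_mono) auto

lemma avg_add: "avg M J (\<lambda>\<tau>. f \<tau> + g \<tau>) \<tau> = avg M J f \<tau> + avg M J g \<tau>"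
  unfolding avg_def by (simp add: sum.distrib add_divide_distrib)

lemma avg_sum: "avg M J (\<lambda>\<tau>. \<Sum>x\<in>X. f x \<tau>) \<tau> = (\<Sum>x\<in>X. avg M J (f x) \<tau>)"
  unfolding avg_def by (subst sum.swap) (simp add: sum_divide_distrib)

lemma avg_mult_unaffected:
  assumes "unaffected J f"
  shows "avg M J (\<lambda>\<tau>. f \<tau> * g \<tau>) \<tau> = f \<tau> * avg M J g \<tau>"
proof -
  have "f (override_on \<tau> \<sigma> J) = f \<tau>" for \<sigma>
    using assms unfolding unaffected_def by (metis override_on_apply_notin)
  then show ?thesis by (simp add: avg_def sum_distrib_left)
qed

lemma avg_union:
  assumes "finite J" "finite K" "J \<inter> K = {}"
  shows "avg M (J \<union> K) f \<tau> = avg M J (avg M K f) \<tau>"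
  using assms(1,3)
  by (induction J arbitrary: \<tau>) (simp_all add: avg_insert assms(2))

text \<open>Independence in product form: whatever the coordinates in \<open>J\<close> are,
  averaging \<open>g\<close> over \<open>K\<close> leaves the same constant.\<close>

lemma avg_union_mult:
  assumes "finite J" "finite K" "J \<inter> K = {}" "unaffected K f" "\<And>\<tau>. avg M K g \<tau> = c"
  shows "avg M (J \<union> K) (\<lambda>\<tau>. f \<tau> * g \<tau>) \<tau> = avg M J f \<tau> * c"
proof -
  have "avg M K (\<lambda>\<tau>. f \<tau> * g \<tau>) = (\<lambda>\<tau>. c * f \<tau>)"
    by (rule ext) (simp add: avg_mult_unaffected[OF assms(4)] assms(5))
  then have "avg M (J \<union> K) (\<lambda>\<tau>. f \<tau> * g \<tau>) \<tau> = avg M J (\<lambda>\<tau>. c * f \<tau>) \<tau>"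
    by (simp add: avg_union assms(1-3))
  also have "\<dots> = c * avg M J f \<tau>"
    by (rule avg_mult_unaffected) (simp add: unaffected_def)
  finally show ?thesis by simp
qed

lemma avg_const:
  assumes "finite J" "M > 0"
  shows "avg M J (\<lambda>_. c) \<tau> = c"
  using assms(1) by (induction J arbitrary: \<tau>) (use assms(2) in \<open>simp_all add: avg_insert\<close>)

text \<open>The law of total expectation. A bound that holds for all values of the other tokens
  survives sampling them, so each event may be estimated through just those tokens that matter for
  it.\<close>

lemma avg_le_superset:
  assumes "\<And>\<tau>. avg M J f \<tau> \<le> b" "J \<subseteq> K" "finite K" "M > 0"
  shows "avg M K f \<tau> \<le> b"
proof -
  have fin: "finite J" using assms finite_subset by blast
  have "avg M K f \<tau> = avg M ((K - J) \<union> J) f \<tau>" using assms(2) by (simp add: Un_absorb2)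
  also have "\<dots> = avg M (K - J) (avg M J f) \<tau>"
    by (rule avg_union) (use assms fin in auto)
  also have "\<dots> \<le> avg M (K - J) (\<lambda>_. b) \<tau>" by (intro avg_mono assms)
  also have "\<dots> = b" using assms by (simp add: avg_const)
  finally show ?thesis .
qed

lemma avg_not:
  assumes "finite J" "M > 0"
  shows "avg M J (\<lambda>\<tau>. of_bool (\<not> B \<tau>)) \<tau> = 1 - avg M J (\<lambda>\<tau>. of_bool (B \<tau>)) \<tau>"
proof -
  have "avg M J (\<lambda>\<tau>. of_bool (\<not> B \<tau>) + of_bool (B \<tau>)) \<tau> = avg M J (\<lambda>_. 1) \<tau>"
    by (rule arg_cong[where f = "\<lambda>f. avg M J f \<tau>"]) auto
  then show ?thesis using avg_const[OF assms, of 1 \<tau>] by (simp add: avg_add)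
qed

text \<open>The events \<open>B q\<close> with \<open>q < p\<close> are already determined when the coordinates \<open>J p\<close> are sampled.\<close>

lemma avg_sequential_le:
  fixes J :: "nat \<Rightarrow> 'i set"
  assumes fin: "\<And>p. p < n \<Longrightarrow> finite (J p)"
    and disj: "\<And>p q. q < p \<Longrightarrow> p < n \<Longrightarrow> J q \<inter> J p = {}"
    and unaff: "\<And>p q. q < p \<Longrightarrow> p < n \<Longrightarrow> unaffected (J p) (B q)"
    and le: "\<And>p \<tau>. p < n \<Longrightarrow> avg M (J p) (\<lambda>\<tau>. of_bool (B p \<tau>)) \<tau> \<le> b"
    and b: "b \<ge> 0"
  shows "avg M (\<Union>p<n. J p) (\<lambda>\<tau>. of_bool (\<forall>p<n. B p \<tau>)) \<tau> \<le> b ^ n"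
  using fin disj unaff le
proof (induction n arbitrary: \<tau>)
  case 0
  then show ?case by simp
next
  case (Suc n)
  let ?A = "\<Union>p<n. J p" and ?f = "\<lambda>\<tau>. of_bool (\<forall>p<n. B p \<tau>) :: real"
  have u: "unaffected (J n) ?f"
    unfolding unaffected_def
  proof (intro allI impI)
    fix \<tau> \<tau>' :: "'i \<Rightarrow> nat" assume agree: "\<forall>i. i \<notin> J n \<longrightarrow> \<tau> i = \<tau>' i"
    have "B p \<tau> = B p \<tau>'" if "p < n" for p
      using Suc.prems(3)[OF that lessI] agree unfolding unaffected_def by blast
    then show "?f \<tau> = ?f \<tau>'" by simp
  qed
  have [simp]: "(\<Union>p<Suc n. J p) = ?A \<union> J n" by (auto simp: less_Suc_eq)
  have split: "(\<lambda>\<tau>. of_bool (\<forall>p<Suc n. B p \<tau>) :: real) = (\<lambda>\<tau>. ?f \<tau> * of_bool (B n \<tau>))"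
    by (auto simp: fun_eq_iff less_Suc_eq)
  have "avg M (?A \<union> J n) (\<lambda>\<tau>. ?f \<tau> * of_bool (B n \<tau>)) \<tau>
      = avg M ?A (avg M (J n) (\<lambda>\<tau>. ?f \<tau> * of_bool (B n \<tau>))) \<tau>"
  proof (rule avg_union)
    show "finite ?A" "finite (J n)" using Suc.prems(1) by auto
    show "?A \<inter> J n = {}" using Suc.prems(2)[OF _ lessI] by blast
  qed
  also have "avg M (J n) (\<lambda>\<tau>. ?f \<tau> * of_bool (B n \<tau>))
      = (\<lambda>\<tau>. ?f \<tau> * avg M (J n) (\<lambda>\<tau>. of_bool (B n \<tau>)) \<tau>)"
    by (rule ext) (rule avg_mult_unaffected[OF u])
  also have "avg M ?A \<dots> \<tau> \<le> avg M ?A (\<lambda>\<tau>. b * ?f \<tau>) \<tau>"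
    using Suc.prems(4) by (intro avg_mono) auto
  also have "\<dots> = b * avg M ?A ?f \<tau>"
    by (rule avg_mult_unaffected) (simp add: unaffected_def)
  also have "\<dots> \<le> b * b ^ n"
    by (intro mult_left_mono Suc.IH) (use Suc.prems b in auto)
  finally show ?case unfolding split by simp
qed

text \<open>The base point \<open>\<lambda>_. undefined\<close> is chosen because overriding it on
  \<open>I\<close> by an extensional \<open>\<sigma>\<close> returns \<open>\<sigma>\<close> itself,
  which turns the average into a count.\<close>

lemma avg_of_bool_eq_card:
  assumes "finite I"
  shows "avg M I (\<lambda>\<tau>. of_bool (B \<tau>)) (\<lambda>_. undefined)
    = real (card {\<sigma> \<in> I \<rightarrow>\<^sub>E {..<M}. B \<sigma>}) / real M ^ card I"
proof -
  have "override_on (\<lambda>_. undefined) \<sigma> I = \<sigma>" if "\<sigma> \<in> I \<rightarrow>\<^sub>E {..<M}" for \<sigma>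
    using that by (auto simp: override_on_def fun_eq_iff PiE_def extensional_def)
  then have "(\<Sum>\<sigma>\<in>I \<rightarrow>\<^sub>E {..<M}. of_bool (B (override_on (\<lambda>_. undefined) \<sigma> I)))
     = (\<Sum>\<sigma>\<in>I \<rightarrow>\<^sub>E {..<M}. of_bool (B \<sigma>) :: real)"
    by (intro sum.cong) auto
  also have "\<dots> = real (card {\<sigma> \<in> I \<rightarrow>\<^sub>E {..<M}. B \<sigma>})"
    using assms by (subst sum_of_bool_eq) (auto simp: finite_PiE Int_def)
  finally show ?thesis by (simp add: avg_def)
qed

section \<open>Coins read off uniform tokens\<close>

lemma card_multiples_lessThan:
  assumes "d > 0"
  shows "card {a. a < d * e \<and> a mod d = (0::nat)} = e"
proof -
  have "{a. a < d * e \<and> a mod d = 0} = (*) d ` {..<e}"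
    using assms by (auto elim!: dvdE simp: mod_eq_0_iff_dvd)
  then show ?thesis using assms by (simp add: card_image inj_on_def)
qed

text \<open>The same token range \<open>2 ^ m\<close> serves for colours and for coins: as
  \<open>k \<le> m\<close>, the multiples of \<open>2 ^ k\<close> make up exactly the fraction
  \<open>1 / 2 ^ k\<close> of it.\<close>

lemma avg_coin:
  assumes "k \<le> m"
  shows "avg (2 ^ m) {i} (\<lambda>\<tau>. of_bool (\<tau> i mod 2 ^ k = 0)) \<tau> = 1 / 2 ^ k"
proof -
  have m: "(2::nat) ^ m = 2 ^ k * 2 ^ (m - k)" using assms by (simp flip: power_add)
  have "(\<Sum>a<(2::nat) ^ m. of_bool (a mod 2 ^ k = 0) :: real)
      = real (card {a. a < (2::nat) ^ m \<and> a mod 2 ^ k = 0})"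
    by (subst sum_of_bool_eq) (auto simp: Int_def intro!: arg_cong[where f = card])
  also have "\<dots> = 2 ^ (m - k)"
    unfolding m by (subst card_multiples_lessThan) auto
  finally show ?thesis using assms by (simp add: avg_singleton power_diff)
qed

lemma avg_no_coins:
  assumes "finite W" "k \<le> m"
  shows "avg (2 ^ m) W (\<lambda>\<tau>. of_bool (\<forall>i\<in>W. \<tau> i mod 2 ^ k \<noteq> 0)) \<tau> = (1 - 1 / 2 ^ k) ^ card W"
  using assms(1)
proof (induction W arbitrary: \<tau>)
  case (insert i W)
  let ?f = "\<lambda>\<tau>. of_bool (\<tau> i mod (2::nat) ^ k \<noteq> 0) :: real"
  have u: "unaffected W ?f"
    using insert.hyps by (simp add: unaffected_def)
  have "avg (2 ^ m) (insert i W) (\<lambda>\<tau>. of_bool (\<forall>j\<in>insert i W. \<tau> j mod 2 ^ k \<noteq> 0)) \<tau>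
      = avg (2 ^ m) ({i} \<union> W) (\<lambda>\<tau>. ?f \<tau> * of_bool (\<forall>j\<in>W. \<tau> j mod 2 ^ k \<noteq> 0)) \<tau>"
    by (intro arg_cong2[where f = "\<lambda>A f. avg (2 ^ m) A f \<tau>"]) auto
  also have "\<dots> = avg (2 ^ m) {i} ?f \<tau> * (1 - 1 / 2 ^ k) ^ card W"
    using insert by (intro avg_union_mult u) auto
  also have "avg (2 ^ m) {i} ?f \<tau> = 1 - 1 / 2 ^ k"
    using avg_not[of "{i}" "2 ^ m" "\<lambda>\<tau>. \<tau> i mod 2 ^ k = 0" \<tau>] avg_coin[OF assms(2), of i \<tau>]
    by simp
  finally show ?case using insert by simp
qed simp

text \<open>The left factor \<open>1 / 4\<close> is the value at \<open>k = 1\<close>, and the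
  sequence does not decrease, since \<open>1 - x \<le> (1 - x / 2) ^ 2\<close>.\<close>

lemma quarter_le_power:
  assumes "k \<ge> 1"
  shows "1 / 4 \<le> (1 - 1 / 2 ^ k :: real) ^ (2 ^ k)"
  using assms
proof (induction k rule: nat_induct_at_least)
  case base
  show ?case by (simp add: power2_eq_square)
next
  case (Suc k)
  define x :: real where "x = 1 / 2 ^ k"
  have x: "0 \<le> x" "x \<le> 1" by (auto simp: x_def)
  have "(1 - x) ^ (2 ^ k) \<le> ((1 - x / 2)\<^sup>2) ^ (2 ^ k)"
    using x by (intro power_mono) (auto simp: power2_eq_square algebra_simps)
  also have "\<dots> = (1 - x / 2) ^ (2 ^ Suc k)" by (simp add: power_mult)
  finally show ?case using Suc by (simp add: x_def mult.commute)
qed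

text \<open>The sender transmits with probability \<open>1 / 2 ^ k\<close>, which is at least
  \<open>1 / (2 * \<Delta>)\<close>, and the at most \<open>2 ^ k\<close> vertices in
  \<open>W\<close> all stay silent with probability at least \<open>1 / 4\<close>. The 8 is the
  product of these two constants.\<close>

lemma avg_single_coin_ge:
  assumes "finite W" "j \<notin> W" "card W \<le> \<Delta>" "k \<le> m" "\<Delta> \<ge> 2" "\<Delta> \<le> 2 ^ k" "2 ^ k \<le> 2 * \<Delta>"
  shows "1 / (8 * real \<Delta>) \<le>
    avg (2 ^ m) (insert j W) (\<lambda>\<tau>. of_bool (\<tau> j mod 2 ^ k = 0 \<and> (\<forall>i\<in>W. \<tau> i mod 2 ^ k \<noteq> 0))) \<tau>"
proof -
  have k: "k \<ge> 1" using assms(5,6) by (cases k) auto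
  have D: "real \<Delta> \<le> 2 ^ k" "2 ^ k \<le> 2 * real \<Delta>"
    using assms(6,7) by (metis of_nat_le_iff of_nat_numeral of_nat_power)
      (metis assms(7) of_nat_le_iff of_nat_mult of_nat_numeral of_nat_power)
  let ?q = "1 / 2 ^ k :: real"
  let ?f = "\<lambda>\<tau>. of_bool (\<tau> j mod (2::nat) ^ k = 0) :: real"
  have u: "unaffected W ?f" using assms(2) by (simp add: unaffected_def)
  have "avg (2 ^ m) (insert j W) (\<lambda>\<tau>. of_bool (\<tau> j mod 2 ^ k = 0 \<and> (\<forall>i\<in>W. \<tau> i mod 2 ^ k \<noteq> 0))) \<tau>
      = avg (2 ^ m) ({j} \<union> W) (\<lambda>\<tau>. ?f \<tau> * of_bool (\<forall>i\<in>W. \<tau> i mod 2 ^ k \<noteq> 0)) \<tau>"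
    by (intro arg_cong2[where f = "\<lambda>A f. avg (2 ^ m) A f \<tau>"]) auto
  also have "\<dots> = avg (2 ^ m) {j} ?f \<tau> * (1 - ?q) ^ card W"
    using assms by (intro avg_union_mult u avg_no_coins) auto
  also have "\<dots> = ?q * (1 - ?q) ^ card W" by (simp only: avg_coin[OF assms(4)])
  finally have eq: "avg (2 ^ m) (insert j W)
      (\<lambda>\<tau>. of_bool (\<tau> j mod 2 ^ k = 0 \<and> (\<forall>i\<in>W. \<tau> i mod 2 ^ k \<noteq> 0))) \<tau> = ?q * (1 - ?q) ^ card W" .
  have "1 / 4 \<le> (1 - ?q) ^ (2 ^ k)" by (rule quarter_le_power[OF k])
  also have "\<dots> \<le> (1 - ?q) ^ card W"
    using assms(3,6) by (intro power_decreasing) auto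
  finally have "?q * (1 / 4) \<le> ?q * (1 - ?q) ^ card W" by (intro mult_left_mono) auto
  moreover have "1 / (8 * real \<Delta>) \<le> ?q * (1 / 4)"
    using D assms(5) by (simp add: field_simps)
  ultimately show ?thesis using eq by linarith
qed

section \<open>Simulation along a colouring\<close>

text \<open>The reception of a single slot, separated from \<open>nocd_hist\<close> so that a
  history becomes a \<open>map\<close> over slots and its prefixes are histories again.\<close>

definition nocd_entry :: "('v \<Rightarrow> 'v \<Rightarrow> bool) \<Rightarrow> ('s \<Rightarrow> bool list \<Rightarrow> 'mb option list \<Rightarrow> 'mb actB)
     \<Rightarrow> ('v \<Rightarrow> 's) \<Rightarrow> ('v \<Rightarrow> bool list) \<Rightarrow> nat \<Rightarrow> 'v \<Rightarrow> 'mb option" where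
  "nocd_entry E b x r t v = (let a = (\<lambda>u. b (x u) (r u) (nocd_hist E b x r t u)) in
     if a v = BListen \<and> (\<exists>!u. E v u \<and> (\<exists>m. a u = BTransmit m))
     then Some (THE m. \<exists>u. E v u \<and> a u = BTransmit m) else None)"

lemma nocd_hist_eq_map: "nocd_hist E b x r t v = map (\<lambda>s. nocd_entry E b x r s v) [0..<t]"
  by (induction t arbitrary: v) (simp_all add: nocd_entry_def Let_def)

lemma length_nocd_hist [simp]: "length (nocd_hist E b x r t v) = t"
  by (simp add: nocd_hist_eq_map)

lemma take_nocd_hist: "t \<le> t' \<Longrightarrow> take t (nocd_hist E b x r t' v) = nocd_hist E b x r t v"
  by (simp add: nocd_hist_eq_map take_map)

lemma nocd_entry_SomeI:
  assumes "b (x v) (r v) (nocd_hist E b x r t v) = BListen" "E v u"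
    and "b (x u) (r u) (nocd_hist E b x r t u) = BTransmit m"
    and "\<And>w m'. E v w \<Longrightarrow> b (x w) (r w) (nocd_hist E b x r t w) = BTransmit m' \<Longrightarrow> w = u"
  shows "nocd_entry E b x r t v = Some m"
proof -
  let ?a = "\<lambda>w. b (x w) (r w) (nocd_hist E b x r t w)"
  have "\<exists>!w. E v w \<and> (\<exists>m. ?a w = BTransmit m)"
    using assms(2,3) by (intro ex1I[of _ u]) (blast intro: assms(4))+
  moreover have "(THE m. \<exists>w. E v w \<and> ?a w = BTransmit m) = m"
  proof (rule the_equality)
    show "\<exists>w. E v w \<and> ?a w = BTransmit m" using assms(2,3) by blast
    fix m' assume "\<exists>w. E v w \<and> ?a w = BTransmit m'"
    then obtain w where "E v w" "?a w = BTransmit m'" by blast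
    then show "m' = m" using assms(3) assms(4)[of w m'] by simp
  qed
  ultimately show ?thesis using assms(1) by (simp add: nocd_entry_def)
qed

definition received :: "'m sim_msg option list \<Rightarrow> 'm multiset" where
  "received es = mset (concat (map (\<lambda>e. case e of None \<Rightarrow> [] | Some m \<Rightarrow> fst m) es))"

text \<open>A No-CD algorithm has no memory beyond its history, so the LOCAL state is recomputed
  from it, one block of \<open>M\<close> entries per LOCAL slot.\<close>

fun sim_state :: "(nat \<Rightarrow> 's \<Rightarrow> 'm multiset \<Rightarrow> 's) \<Rightarrow> nat \<Rightarrow> nat \<Rightarrow> 's
    \<Rightarrow> 'm sim_msg option list \<Rightarrow> nat \<Rightarrow> 's" where
  "sim_state upd S M s h 0 = s"
| "sim_state upd S M s h (Suc t) =
     upd t (sim_state upd S M s h t) (received (take M (drop (S + t * M) h)))"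

text \<open>Only blocks before LOCAL slot \<open>t\<close> are read. Hence a vertex sees the same
  simulated state throughout the block of slot \<open>t\<close>, no matter what it has already
  received in it.\<close>

lemma sim_state_take:
  "S + t * M \<le> n \<Longrightarrow> sim_state upd S M s (take n h) t = sim_state upd S M s h t"
  by (induction t) (simp_all add: drop_take min_absorb1)

text \<open>The first \<open>S\<close> slots are spent on a setup \<open>sdec\<close>; the setup history determines a colour and a
  set of slot numbers to listen to. Afterwards LOCAL slot \<open>t\<close> occupies the \<open>M\<close> slots
  \<open>S + t * M + j\<close>, in which \<open>j\<close> runs through the colours.\<close>

definition sim_act :: "(nat \<Rightarrow> 's \<Rightarrow> 'm option \<times> bool) \<Rightarrow> (nat \<Rightarrow> 's \<Rightarrow> 'm multiset \<Rightarrow> 's)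
    \<Rightarrow> nat \<Rightarrow> nat \<Rightarrow> (bool list \<Rightarrow> 'm sim_msg option list \<Rightarrow> 'm sim_msg actB)
    \<Rightarrow> (bool list \<Rightarrow> 'm sim_msg option list \<Rightarrow> nat)
    \<Rightarrow> (bool list \<Rightarrow> 'm sim_msg option list \<Rightarrow> nat set)
    \<Rightarrow> 's \<Rightarrow> bool list \<Rightarrow> 'm sim_msg option list \<Rightarrow> 'm sim_msg actB" where
  "sim_act act upd S M sdec col lis s r h =
    (if length h < S then sdec r h
     else let t = (length h - S) div M; j = (length h - S) mod M;
              a = act t (sim_state upd S M s h t)
          in if fst a \<noteq> None \<and> j = col r (take S h) then BTransmit ([the (fst a)], [])
             else if snd a \<and> j \<in> lis r (take S h) then BListen else BIdle)"

text \<open>Here \<open>c\<close> and \<open>l\<close> are the colours and listening sets that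
  result from one particular run of the setup. \<open>c_in\<close> and \<open>c_notin\<close>
  together make adjacent vertices differ, \<open>c_distinct\<close> handles distance two. How the
  colouring arises is left open, so that the case of a single edge is covered as well.\<close>

locale tdma =
  fixes V :: "'v set" and E :: "'v \<Rightarrow> 'v \<Rightarrow> bool"
    and act :: "nat \<Rightarrow> 's \<Rightarrow> 'm option \<times> bool" and upd :: "nat \<Rightarrow> 's \<Rightarrow> 'm multiset \<Rightarrow> 's"
    and S M :: nat
    and sdec :: "bool list \<Rightarrow> 'm sim_msg option list \<Rightarrow> 'm sim_msg actB"
    and col :: "bool list \<Rightarrow> 'm sim_msg option list \<Rightarrow> nat"
    and lis :: "bool list \<Rightarrow> 'm sim_msg option list \<Rightarrow> nat set"
    and x :: "'v \<Rightarrow> 's" and r :: "'v \<Rightarrow> bool list"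
    and b h c l
  assumes b_def: "b = sim_act act upd S M sdec col lis"
    and h_def: "h = nocd_hist E b x r"
    and c_def: "c = (\<lambda>v. col (r v) (h S v))" and l_def: "l = (\<lambda>v. lis (r v) (h S v))"
    and fin: "finite V" and E_V: "\<And>u v. E u v \<Longrightarrow> u \<in> V \<and> v \<in> V"
    and c_less: "\<And>v. v \<in> V \<Longrightarrow> c v < M"
    and c_notin: "\<And>v. v \<in> V \<Longrightarrow> c v \<notin> l v"
    and c_in: "\<And>v u. E v u \<Longrightarrow> c u \<in> l v"
    and c_distinct: "\<And>v u w. E v u \<Longrightarrow> E v w \<Longrightarrow> c u = c w \<Longrightarrow> u = w"
begin

abbreviation (input) st where "st \<equiv> local_run E act upd x"

lemma action_eq:
  assumes "sim_state upd S M (x v) (h (S + t * M) v) t = st t v" "j < M"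
  shows "b (x v) (r v) (h (S + t * M + j) v) =
    (if fst (act t (st t v)) \<noteq> None \<and> j = c v then BTransmit ([the (fst (act t (st t v)))], [])
     else if snd (act t (st t v)) \<and> j \<in> l v then BListen else BIdle)"
proof -
  define h' where "h' = h (S + t * M + j) v"
  have "sim_state upd S M (x v) h' t = sim_state upd S M (x v) (take (S + t * M) h') t"
    by (rule sim_state_take[symmetric]) simp
  also have "take (S + t * M) h' = h (S + t * M) v"
    unfolding h'_def h_def by (rule take_nocd_hist) simp
  finally have 1: "sim_state upd S M (x v) h' t = st t v" using assms(1) by simp
  have 2: "take S h' = h S v" unfolding h'_def h_def by (rule take_nocd_hist) simp
  have 3: "length h' = S + t * M + j" by (simp add: h'_def h_def)
  have "(t * M + j) div M = t" "(t * M + j) mod M = j" using assms(2) by auto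
  then show ?thesis
    unfolding h'_def[symmetric] using 1 2 3 by (simp add: b_def sim_act_def Let_def c_def l_def add.assoc)
qed

text \<open>In the slot of a transmitting neighbour's colour that neighbour is the only one to
  transmit among all neighbours of \<open>v\<close>, and in every other slot no neighbour does.
  Being half duplex costs nothing, as no neighbour of \<open>v\<close> uses the slot in which
  \<open>v\<close> itself may transmit.\<close>

lemma received_slot:
  assumes IH: "\<And>v. v \<in> V \<Longrightarrow> sim_state upd S M (x v) (h (S + t * M) v) t = st t v"
    and v: "v \<in> V" and h': "h' = h (S + Suc t * M) v"
  shows "received (take M (drop (S + t * M) h')) =
    (if snd (act t (st t v))
     then image_mset (\<lambda>u. the (fst (act t (st t u))))
            (mset_set {u. E v u \<and> fst (act t (st t u)) \<noteq> None})
     else {#})"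
proof -
  let ?m = "\<lambda>u. the (fst (act t (st t u)))"
  let ?B = "{u. E v u \<and> fst (act t (st t u)) \<noteq> None}"
  let ?e = "\<lambda>j. nocd_entry E b x r (S + t * M + j) v"
  let ?g = "\<lambda>j. mset (case ?e j of None \<Rightarrow> [] | Some m \<Rightarrow> fst m)"
  have finB: "finite ?B" using E_V by (intro finite_subset[OF _ fin]) auto
  have act_eq: "b (x u) (r u) (nocd_hist E b x r (S + t * M + j) u) =
    (if fst (act t (st t u)) \<noteq> None \<and> j = c u then BTransmit ([?m u], [])
     else if snd (act t (st t u)) \<and> j \<in> l u then BListen else BIdle)" if "u \<in> V" "j < M" for u j
    using action_eq[OF IH[OF that(1)] that(2)] by (simp add: h_def)
  have some: "?e (c u) = Some ([?m u], [])" if u: "u \<in> ?B" and a: "snd (act t (st t v))" for u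
  proof (rule nocd_entry_SomeI[of _ _ _ _ _ _ u])
    have uV: "u \<in> V" "c u < M" using u E_V c_less by auto
    show "E v u" using u by simp
    show "b (x v) (r v) (nocd_hist E b x r (S + t * M + c u) v) = BListen"
      using act_eq[OF v uV(2)] a c_in[of v u] c_notin[OF v] u by auto
    show "b (x u) (r u) (nocd_hist E b x r (S + t * M + c u) u) = BTransmit ([?m u], [])"
      using act_eq[OF uV] u by simp
    fix w m' assume w: "E v w" "b (x w) (r w) (nocd_hist E b x r (S + t * M + c u) w) = BTransmit m'"
    then have "c u = c w" using act_eq[of w "c u"] uV E_V by (auto split: if_splits)
    then show "w = u" using c_distinct[of v w u] w u by auto
  qed
  have none: "?e j = None" if "j < M" "\<not> (snd (act t (st t v)) \<and> j \<in> c ` ?B)" for j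
  proof (rule ccontr)
    assume "?e j \<noteq> None"
    then obtain u m where *: "b (x v) (r v) (nocd_hist E b x r (S + t * M + j) v) = BListen"
        "E v u" "b (x u) (r u) (nocd_hist E b x r (S + t * M + j) u) = BTransmit m"
      by (auto simp: nocd_entry_def Let_def split: if_splits)
    then have "u \<in> V" using E_V by blast
    then show False using * act_eq[OF v that(1)] act_eq[OF _ that(1), of u] that(2)
      by (auto split: if_splits)
  qed
  have "take M (drop (S + t * M) h') = map ?e [0..<M]"
    by (rule nth_equalityI) (simp_all add: h' h_def nocd_hist_eq_map del: upt_Suc)
  then have "received (take M (drop (S + t * M) h'))
      = mset (concat (map (\<lambda>j. case ?e j of None \<Rightarrow> [] | Some m \<Rightarrow> fst m) [0..<M]))"
    by (simp add: received_def comp_def)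
  also have "\<dots> = (\<Sum>j<M. ?g j)"
    unfolding mset_concat by (simp add: interv_sum_list_conv_sum_set_nat atLeast0LessThan comp_def)
  also have "\<dots> = (if snd (act t (st t v)) then image_mset ?m (mset_set ?B) else {#})"
  proof (cases "snd (act t (st t v))")
    case True
    \<comment> \<open>Slots that are not the colour of a transmitting neighbour contribute nothing,
      and on these neighbours \<open>c\<close> is injective, so the sum over slots becomes a sum
      over senders.\<close>
    have "(\<Sum>j<M. ?g j) = (\<Sum>j\<in>c ` ?B. ?g j)"
      using c_less E_V none finB by (intro sum.mono_neutral_right) auto
    also have "\<dots> = (\<Sum>u\<in>?B. ?g (c u))"
      by (rule sum.reindex_cong[of c]) (auto simp: inj_on_def intro: c_distinct)
    also have "\<dots> = (\<Sum>u\<in>?B. {#?m u#})"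
      using some True by (intro sum.cong) auto
    also have "\<dots> = image_mset ?m (mset_set ?B)"
      using finB by (induction rule: finite_induct) auto
    finally show ?thesis using True by simp
  next
    case False
    then show ?thesis using none by simp
  qed
  finally show ?thesis .
qed

lemma sim_state_eq_local_run:
  "v \<in> V \<Longrightarrow> sim_state upd S M (x v) (h (S + t * M) v) t = st t v"
proof (induction t arbitrary: v)
  case (Suc t)
  let ?h = "h (S + Suc t * M) v"
  have "take (S + t * M) ?h = h (S + t * M) v"
    unfolding h_def by (rule take_nocd_hist) simp
  then have "sim_state upd S M (x v) ?h t = st t v"
    using Suc sim_state_take[of S t M "S + t * M" upd "x v" ?h] by simp
  then show ?case
    using received_slot[OF Suc.IH Suc.prems refl] by (simp add: Let_def)
qed simp

text \<open>Setup slots are all charged. Afterwards a slot is charged only if its LOCAL slot is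
  active, and then it is the own colour or belongs to the listening set.\<close>

lemma nocd_energy_le:
  assumes v: "v \<in> V" and "local_energy E act upd x T v \<le> En" and finl: "finite (l v)"
  shows "nocd_energy E b x r (S + T * M) v \<le> S + En * (1 + card (l v))"
proof -
  let ?A = "{t. t < T \<and> (fst (act t (st t v)) \<noteq> None \<or> snd (act t (st t v)))}"
  let ?f = "\<lambda>(t, j). S + t * M + j"
  have "{s. s < S + T * M \<and> b (x v) (r v) (h s v) \<noteq> BIdle}
      \<subseteq> {..<S} \<union> ?f ` (?A \<times> insert (c v) (l v))"
  proof
    fix s assume s: "s \<in> {s. s < S + T * M \<and> b (x v) (r v) (h s v) \<noteq> BIdle}"
    show "s \<in> {..<S} \<union> ?f ` (?A \<times> insert (c v) (l v))"
    proof (cases "s < S")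
      case False
      define t j where "t = (s - S) div M" and "j = (s - S) mod M"
      have M: "M > 0" using c_less[OF v] by simp
      have sj: "s = S + t * M + j" "j < M" using False M by (auto simp: t_def j_def)
      have "t < T" unfolding t_def using s False M by (simp add: div_less_iff_less_mult less_diff_conv2)
      moreover have "fst (act t (st t v)) \<noteq> None \<and> j = c v \<or> snd (act t (st t v)) \<and> j \<in> l v"
        using s action_eq[OF sim_state_eq_local_run[OF v] sj(2)] unfolding sj(1)
        by (auto split: if_splits)
      ultimately have "(t, j) \<in> ?A \<times> insert (c v) (l v)" by auto
      then show ?thesis using sj(1) by force
    qed simp
  qed
  then have "nocd_energy E b x r (S + T * M) v
      \<le> card ({..<S} \<union> ?f ` (?A \<times> insert (c v) (l v)))"
    unfolding nocd_energy_def h_def using finl by (intro card_mono) auto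
  also have "\<dots> \<le> S + card (?A \<times> insert (c v) (l v))"
    by (intro order_trans[OF card_Un_le] add_mono card_image_le) (use finl in auto)
  also have "card (?A \<times> insert (c v) (l v)) = local_energy E act upd x T v * (1 + card (l v))"
    using c_notin[OF v] finl by (simp add: card_cartesian_product local_energy_def Let_def)
  finally show ?thesis using assms(2) by (meson add_left_mono mult_le_mono1 order_trans)
qed

end

section \<open>The colouring protocol\<close>

text \<open>Token \<open>s\<close> of a vertex is its coin for setup slot \<open>s\<close>, token \<open>4 * S + p\<close> its candidate colour in
  phase \<open>p\<close>, and tokens \<open>0, \<dots>, S - 1\<close> together serve as its identifier. The setup consists of
  neighbour discovery in slots \<open>[0, S)\<close>, of \<open>P\<close> phases of \<open>2 * l\<close> slots each, and of the exchange of
  final colours in slots \<open>[3 * S, 4 * S)\<close>. Every message starts with the sender's identifier. In a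
  phase, a vertex first offers its colour; whoever got the offers of all its neighbours then sends
  the identifiers of those whose offers are free of conflicts; unanimous approval makes the colour
  of a vertex final.\<close>

locale setup_params =
  fixes k l P :: nat
begin

definition S :: nat where "S = P * l"

definition coin :: "(nat \<Rightarrow> nat) \<Rightarrow> nat \<Rightarrow> bool" where
  "coin \<tau> s \<longleftrightarrow> \<tau> s mod 2 ^ k = 0"

definition heard :: "nat \<Rightarrow> nat \<Rightarrow> (nat \<Rightarrow> nat list option) \<Rightarrow> nat list set" where
  "heard a b e = {xs. \<exists>s. a \<le> s \<and> s < b \<and> e s = Some xs}"

definition ident :: "(nat \<Rightarrow> nat) \<Rightarrow> nat" where
  "ident \<tau> = to_nat (map \<tau> [0..<S])"

definition nbrs :: "(nat \<Rightarrow> nat list option) \<Rightarrow> nat set" where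
  "nbrs e = hd ` heard 0 S e"

definition cand :: "nat \<Rightarrow> (nat \<Rightarrow> nat) \<Rightarrow> nat" where
  "cand p \<tau> = \<tau> (4 * S + p)"

definition phase :: "nat \<Rightarrow> nat" where "phase p = S + 2 * p * l"

definition offers :: "nat \<Rightarrow> (nat \<Rightarrow> nat list option) \<Rightarrow> nat list set" where
  "offers p e = heard (phase p) (phase p + l) e"

definition votes :: "nat \<Rightarrow> (nat \<Rightarrow> nat list option) \<Rightarrow> nat list set" where
  "votes p e = heard (phase p + l) (phase (Suc p)) e"

fun final :: "nat \<Rightarrow> (nat \<Rightarrow> nat) \<Rightarrow> (nat \<Rightarrow> nat list option) \<Rightarrow> nat option" where
  "final 0 \<tau> e = None"
| "final (Suc p) \<tau> e = (case final p \<tau> e of Some c \<Rightarrow> Some c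
     | None \<Rightarrow> if \<forall>i\<in>nbrs e. \<exists>xs. i # xs \<in> votes p e \<and> ident \<tau> \<in> set xs
               then Some (cand p \<tau>) else None)"

text \<open>Vertices whose colour is final keep offering it, so that later candidates are compared
  with it too. For \<open>p = P\<close> the case \<open>None\<close> reads a token that is never
  sampled; it does not arise in runs satisfying \<open>good\<close>.\<close>

definition colour :: "nat \<Rightarrow> (nat \<Rightarrow> nat) \<Rightarrow> (nat \<Rightarrow> nat list option) \<Rightarrow> nat" where
  "colour p \<tau> e = (case final p \<tau> e of Some c \<Rightarrow> c | None \<Rightarrow> cand p \<tau>)"

text \<open>The common neighbour acts as the judge: comparing an offer with its own colour and with
  the offers of its other neighbours detects conflicts at distance one and two alike. Without the
  offers of all neighbours it approves nobody.\<close>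

definition approvable :: "nat \<Rightarrow> (nat \<Rightarrow> nat) \<Rightarrow> (nat \<Rightarrow> nat list option) \<Rightarrow> nat set" where
  "approvable p \<tau> e = {i. nbrs e \<subseteq> hd ` offers p e \<and>
     (\<exists>a. [i, a] \<in> offers p e \<and> a \<noteq> colour p \<tau> e \<and>
          (\<forall>j a'. [j, a'] \<in> offers p e \<and> j \<noteq> i \<longrightarrow> a' \<noteq> a))}"

definition setup_msg :: "nat \<Rightarrow> (nat \<Rightarrow> nat) \<Rightarrow> (nat \<Rightarrow> nat list option) \<Rightarrow> nat list" where
  "setup_msg s \<tau> e = ident \<tau> #
     (if s < S then []
      else if s < 3 * S then
        (let p = (s - S) div (2 * l) in
         if (s - S) mod (2 * l) < l then [colour p \<tau> e] else sorted_list_of_set (approvable p \<tau> e))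
      else [colour P \<tau> e])"

section \<open>Slot arithmetic and locality of the protocol state\<close>

lemma phase_P [simp]: "phase P = 3 * S" by (simp add: phase_def S_def)

lemma phase_Suc: "phase (Suc p) = phase p + 2 * l" by (simp add: phase_def)

lemma phase_mono: "p \<le> q \<Longrightarrow> phase p \<le> phase q" by (simp add: phase_def)

lemma S_le_phase: "S \<le> phase p" by (simp add: phase_def)

lemma finite_heard: "finite (heard a b e)"
proof (rule finite_subset)
  show "heard a b e \<subseteq> (the \<circ> e) ` {a..<b}" by (force simp: heard_def)
qed simp

lemma heard_cong: "(\<And>i. i < b \<Longrightarrow> e i = e' i) \<Longrightarrow> heard a b e = heard a b e'"
  by (auto simp: heard_def)

lemma ident_cong: "(\<And>i. i < S \<Longrightarrow> \<tau> i = \<tau>' i) \<Longrightarrow> ident \<tau> = ident \<tau>'"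
  by (simp add: ident_def cong: map_cong)

lemma ident_eqD: "ident \<tau> = ident \<tau>' \<Longrightarrow> i < S \<Longrightarrow> \<tau> i = \<tau>' i"
  by (simp add: ident_def)

lemma final_cong:
  assumes "\<And>i. i < phase p \<Longrightarrow> e i = e' i" "\<And>i. i < S \<Longrightarrow> \<tau> i = \<tau>' i" "\<And>q. q < p \<Longrightarrow> cand q \<tau> = cand q \<tau>'"
  shows "final p \<tau> e = final p \<tau>' e'"
  using assms
proof (induction p)
  case (Suc p)
  have "nbrs e = nbrs e'"
    using Suc.prems(1) S_le_phase[of "Suc p"] unfolding nbrs_def by (subst heard_cong) auto
  moreover have "votes p e = votes p e'"
    using Suc.prems(1) unfolding votes_def by (intro heard_cong) auto
  moreover have "ident \<tau> = ident \<tau>'" using Suc.prems(2) by (rule ident_cong)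
  moreover have "final p \<tau> e = final p \<tau>' e'"
    using Suc.prems by (intro Suc.IH) (auto simp: phase_Suc)
  ultimately show ?case using Suc.prems(3)[OF lessI] by (simp only: final.simps)
qed simp

lemma colour_cong:
  assumes "\<And>i. i < phase p \<Longrightarrow> e i = e' i" "\<And>i. i < S \<Longrightarrow> \<tau> i = \<tau>' i" "\<And>q. q \<le> p \<Longrightarrow> cand q \<tau> = cand q \<tau>'"
  shows "colour p \<tau> e = colour p \<tau>' e'"
proof -
  have "final p \<tau> e = final p \<tau>' e'" by (rule final_cong) (use assms in auto)
  then show ?thesis using assms(3)[OF order_refl] by (simp only: colour_def)
qed

lemma approvable_cong:
  assumes "\<And>i. i < phase p + l \<Longrightarrow> e i = e' i" "\<And>i. i < S \<Longrightarrow> \<tau> i = \<tau>' i" "\<And>q. q \<le> p \<Longrightarrow> cand q \<tau> = cand q \<tau>'"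
  shows "approvable p \<tau> e = approvable p \<tau>' e'"
proof -
  have "nbrs e = nbrs e'"
    using assms(1) S_le_phase[of p] unfolding nbrs_def by (subst heard_cong) auto
  moreover have "offers p e = offers p e'"
    using assms(1) unfolding offers_def by (intro heard_cong) auto
  moreover have "colour p \<tau> e = colour p \<tau>' e'"
    by (rule colour_cong) (use assms in auto)
  ultimately show ?thesis by (simp add: approvable_def)
qed

lemma setup_msg_discovery: "s < S \<Longrightarrow> setup_msg s \<tau> e = [ident \<tau>]"
  by (simp add: setup_msg_def)

lemma setup_msg_exchange: "3 * S \<le> s \<Longrightarrow> s < 4 * S \<Longrightarrow> setup_msg s \<tau> e = [ident \<tau>, colour P \<tau> e]"
  by (simp add: setup_msg_def)

lemma setup_msg_phase:
  assumes "p < P" "j < 2 * l"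
  shows "setup_msg (phase p + j) \<tau> e = ident \<tau> #
    (if j < l then [colour p \<tau> e] else sorted_list_of_set (approvable p \<tau> e))"
proof -
  have "phase p + j < phase (Suc p)" using assms(2) by (simp add: phase_Suc)
  also have "\<dots> \<le> 3 * S" using phase_mono[of "Suc p" P] assms(1) by simp
  finally have 1: "phase p + j < 3 * S" .
  have 2: "phase p + j - S = p * (2 * l) + j" by (simp add: phase_def)
  have "(p * (2 * l) + j) div (2 * l) = p" "(p * (2 * l) + j) mod (2 * l) = j" using assms(2) by auto
  then show ?thesis
    using 1 S_le_phase[of p] unfolding setup_msg_def 2 by (simp add: Let_def)
qed

lemma slot_cases:
  assumes "s < 4 * S"
  obtains "s < S" | p j where "p < P" "j < 2 * l" "s = phase p + j" | "3 * S \<le> s"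
proof -
  consider "s < S" | "3 * S \<le> s" | "S \<le> s" "s < 3 * S" by linarith
  then show ?thesis
  proof cases
    case 3
    let ?p = "(s - S) div (2 * l)" and ?j = "(s - S) mod (2 * l)"
    have "S > 0" using 3 by linarith
    then have l: "l > 0" by (simp add: S_def)
    have "s - S < P * (2 * l)" using 3 by (simp add: S_def)
    then have "?p < P" using l by (simp add: div_less_iff_less_mult)
    moreover have "s = phase ?p + ?j"
    proof -
      have "s - S = ?p * (2 * l) + ?j" by (rule div_mult_mod_eq[symmetric])
      then have "s = S + (?p * (2 * l) + ?j)" using 3(1) by linarith
      then show ?thesis by (simp add: phase_def algebra_simps)
    qed
    ultimately show ?thesis using that(2)[of ?p ?j] l by simp
  qed (use that in auto)
qed

text \<open>Messages refer to earlier receptions only, which justifies the recursion over slots in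
  \<open>ent\<close>. Candidate \<open>q\<close> is not read before slot \<open>phase q\<close>, so
  it is still fresh when phase \<open>q\<close> begins.\<close>

lemma setup_msg_cong:
  assumes "s < 4 * S" "\<And>i. i < s \<Longrightarrow> e i = e' i" "\<And>i. i < S \<Longrightarrow> \<tau> i = \<tau>' i"
    "\<And>q. phase q \<le> s \<Longrightarrow> cand q \<tau> = cand q \<tau>'"
  shows "setup_msg s \<tau> e = setup_msg s \<tau>' e'"
proof -
  have id: "ident \<tau> = ident \<tau>'" using assms(3) by (rule ident_cong)
  show ?thesis
  proof (rule slot_cases[OF assms(1)])
    fix p j assume p: "p < P" "j < 2 * l" "s = phase p + j"
    have cand: "cand q \<tau> = cand q \<tau>'" if "q \<le> p" for q
      using assms(4)[of q] phase_mono[OF that] p(3) by linarith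
    have "colour p \<tau> e = colour p \<tau>' e'"
      by (rule colour_cong) (use assms p cand in auto)
    moreover have "approvable p \<tau> e = approvable p \<tau>' e'" if "\<not> j < l"
      by (rule approvable_cong) (use assms p cand that in auto)
    ultimately show ?thesis using p id by (simp add: setup_msg_phase)
  next
    assume s: "3 * S \<le> s"
    have "colour P \<tau> e = colour P \<tau>' e'"
    proof (rule colour_cong)
      show "cand q \<tau> = cand q \<tau>'" if "q \<le> P" for q
        using assms(4)[of q] phase_mono[OF that] s by simp
    qed (use assms s in auto)
    then show ?thesis using s id assms(1) by (simp add: setup_msg_exchange)
  qed (simp add: setup_msg_discovery id)
qed

lemma final_Suc_eq_NoneD:
  "final (Suc p) \<tau> e = None \<Longrightarrow>
    final p \<tau> e = None \<and> \<not> (\<forall>i\<in>nbrs e. \<exists>xs. i # xs \<in> votes p e \<and> ident \<tau> \<in> set xs)"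
  by (auto split: option.splits if_splits)

lemma final_eq_Some_cand: "final p \<tau> e = Some a \<Longrightarrow> \<exists>q<p. a = cand q \<tau>"
proof (induction p)
  case (Suc p)
  then show ?case by (cases "final p \<tau> e") (auto split: if_splits intro: less_SucI)
qed simp

lemma set_approved: "set (sorted_list_of_set (approvable p \<tau> e)) = approvable p \<tau> e"
proof (rule set_sorted_list_of_set, rule finite_subset)
  show "approvable p \<tau> e \<subseteq> hd ` offers p e" by (force simp: approvable_def)
qed (simp add: offers_def finite_heard)

end

section \<open>The setup run on a graph, in terms of tokens\<close>

locale network = setup_params +
  fixes V :: "'v set" and E :: "'v \<Rightarrow> 'v \<Rightarrow> bool"
  assumes fin: "finite V" and E_V: "\<And>u v. E u v \<Longrightarrow> u \<in> V \<and> v \<in> V"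
    and sym: "\<And>u v. E u v \<Longrightarrow> E v u" and irrefl: "\<And>v. \<not> E v v"
begin

abbreviation tk :: "('v \<times> nat \<Rightarrow> nat) \<Rightarrow> 'v \<Rightarrow> nat \<Rightarrow> nat" where
  "tk \<tau> v \<equiv> \<lambda>i. \<tau> (v, i)"

text \<open>Only coins of slot \<open>s\<close> occur, no message contents: this is the
  obliviousness that makes receptions in different slots independent.\<close>

definition hears :: "('v \<times> nat \<Rightarrow> nat) \<Rightarrow> nat \<Rightarrow> 'v \<Rightarrow> 'v \<Rightarrow> bool" where
  "hears \<tau> s v u \<longleftrightarrow> E v u \<and> coin (tk \<tau> u) s \<and> \<not> coin (tk \<tau> v) s \<and>
     (\<forall>w. E v w \<and> w \<noteq> u \<longrightarrow> \<not> coin (tk \<tau> w) s)"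

definition hears_in :: "('v \<times> nat \<Rightarrow> nat) \<Rightarrow> nat \<Rightarrow> nat \<Rightarrow> 'v \<Rightarrow> 'v \<Rightarrow> bool" where
  "hears_in \<tau> a b v u \<longleftrightarrow> (\<exists>s. a \<le> s \<and> s < b \<and> hears \<tau> s v u)"

text \<open>The receptions of the setup expressed through tokens directly;
  \<open>nocd_entry_setup\<close> identifies them with the real history. The guard
  \<open>i < s\<close> is there for termination, and \<open>ent_eq_Some'\<close> removes it because
  \<open>setup_msg\<close> ignores the present and the future.\<close>

fun ent :: "('v \<times> nat \<Rightarrow> nat) \<Rightarrow> nat \<Rightarrow> 'v \<Rightarrow> nat list option" where
  "ent \<tau> s v = (if \<exists>u. hears \<tau> s v u
     then Some (setup_msg s (tk \<tau> (THE u. hears \<tau> s v u))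
                  (\<lambda>i. if i < s then ent \<tau> i (THE u. hears \<tau> s v u) else None))
     else None)"

declare ent.simps [simp del]

abbreviation en :: "('v \<times> nat \<Rightarrow> nat) \<Rightarrow> 'v \<Rightarrow> nat \<Rightarrow> nat list option" where
  "en \<tau> v \<equiv> \<lambda>i. ent \<tau> i v"

abbreviation idt where "idt \<tau> v \<equiv> ident (tk \<tau> v)"
abbreviation clr where "clr \<tau> p v \<equiv> colour p (tk \<tau> v) (en \<tau> v)"
abbreviation fnl where "fnl \<tau> p v \<equiv> final p (tk \<tau> v) (en \<tau> v)"

lemma hears_unique: "hears \<tau> s v u \<Longrightarrow> hears \<tau> s v w \<Longrightarrow> u = w"
  by (auto simp: hears_def)

lemma the_hears: "hears \<tau> s v u \<Longrightarrow> (THE u. hears \<tau> s v u) = u"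
  by (blast intro: hears_unique the_equality)

lemma hears_in_E: "hears_in \<tau> a b v u \<Longrightarrow> E v u"
  by (auto simp: hears_in_def hears_def)

lemma ent_eq_Some:
  assumes "hears \<tau> s v u"
  shows "ent \<tau> s v = Some (setup_msg s (tk \<tau> u) (\<lambda>i. if i < s then ent \<tau> i u else None))"
  unfolding ent.simps[of \<tau> s v] the_hears[OF assms] using assms by auto

lemma ent_eq_None: "(\<And>u. \<not> hears \<tau> s v u) \<Longrightarrow> ent \<tau> s v = None"
  by (subst ent.simps) simp

lemma ent_eq_Some':
  assumes "hears \<tau> s v u" "s < 4 * S"
  shows "ent \<tau> s v = Some (setup_msg s (tk \<tau> u) (en \<tau> u))"
  unfolding ent_eq_Some[OF assms(1)] using assms(2)
  by (intro arg_cong[where f = Some] setup_msg_cong) auto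

text \<open>While every sender repeats one fixed message, it only matters who was heard, not when or
  how often.\<close>

lemma heard_en:
  assumes "b \<le> 4 * S" "\<And>s u. a \<le> s \<Longrightarrow> s < b \<Longrightarrow> setup_msg s (tk \<tau> u) (en \<tau> u) = msg u"
  shows "heard a b (en \<tau> v) = msg ` {u. hears_in \<tau> a b v u}"
proof (rule set_eqI)
  fix xs
  have "ent \<tau> s v = Some xs \<longleftrightarrow> (\<exists>u. hears \<tau> s v u \<and> xs = msg u)" if "a \<le> s" "s < b" for s
  proof (cases "\<exists>u. hears \<tau> s v u")
    case True
    then obtain u where u: "hears \<tau> s v u" by blast
    have "s < 4 * S" using that assms(1) by simp
    then have "ent \<tau> s v = Some (msg u)" using ent_eq_Some'[OF u] assms(2)[OF that] by simp
    then show ?thesis using u by (metis hears_unique option.inject)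
  qed (use ent_eq_None in auto)
  then show "xs \<in> heard a b (en \<tau> v) \<longleftrightarrow> xs \<in> msg ` {u. hears_in \<tau> a b v u}"
    unfolding heard_def hears_in_def by blast
qed

lemma nbrs_en: "nbrs (en \<tau> v) = idt \<tau> ` {u. hears_in \<tau> 0 S v u}"
proof -
  have "heard 0 S (en \<tau> v) = (\<lambda>u. [idt \<tau> u]) ` {u. hears_in \<tau> 0 S v u}"
    by (rule heard_en) (auto simp: setup_msg_discovery)
  then show ?thesis by (simp add: nbrs_def image_image)
qed

lemma phase_Suc_le: "p < P \<Longrightarrow> phase (Suc p) \<le> 3 * S"
  using phase_mono[of "Suc p" P] by simp

lemma offers_en:
  assumes "p < P"
  shows "offers p (en \<tau> v) = (\<lambda>u. [idt \<tau> u, clr \<tau> p u]) ` {u. hears_in \<tau> (phase p) (phase p + l) v u}"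
  unfolding offers_def
proof (rule heard_en)
  show "phase p + l \<le> 4 * S" using phase_Suc_le[OF assms] by (simp add: phase_Suc)
  fix s u assume "phase p \<le> s" "s < phase p + l"
  then show "setup_msg s (tk \<tau> u) (en \<tau> u) = [idt \<tau> u, clr \<tau> p u]"
    using setup_msg_phase[OF assms, of "s - phase p"] by simp
qed

lemma votes_en:
  assumes "p < P"
  shows "votes p (en \<tau> v) = (\<lambda>u. idt \<tau> u # sorted_list_of_set (approvable p (tk \<tau> u) (en \<tau> u))) `
    {u. hears_in \<tau> (phase p + l) (phase (Suc p)) v u}"
  unfolding votes_def
proof (rule heard_en)
  show "phase (Suc p) \<le> 4 * S" using phase_Suc_le[OF assms] by simp
  fix s u assume "phase p + l \<le> s" "s < phase (Suc p)"
  then show "setup_msg s (tk \<tau> u) (en \<tau> u)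
      = idt \<tau> u # sorted_list_of_set (approvable p (tk \<tau> u) (en \<tau> u))"
    using setup_msg_phase[OF assms, of "s - phase p"] by (simp add: phase_Suc)
qed

lemma exchange_en:
  "heard (3 * S) (4 * S) (en \<tau> v) = (\<lambda>u. [idt \<tau> u, clr \<tau> P u]) ` {u. hears_in \<tau> (3 * S) (4 * S) v u}"
  by (rule heard_en) (auto simp: setup_msg_exchange)

section \<open>Safety: final colours differ up to distance two\<close>

definition identified :: "('v \<times> nat \<Rightarrow> nat) \<Rightarrow> bool" where
  "identified \<tau> \<longleftrightarrow> inj_on (idt \<tau>) V \<and> (\<forall>v u. E v u \<longrightarrow> hears_in \<tau> 0 S v u)"

lemma nbrs_identified: "identified \<tau> \<Longrightarrow> nbrs (en \<tau> v) = idt \<tau> ` {u. E v u}"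
  unfolding nbrs_en identified_def by (auto dest: hears_in_E)

lemma idt_inj: "identified \<tau> \<Longrightarrow> u \<in> V \<Longrightarrow> w \<in> V \<Longrightarrow> idt \<tau> u = idt \<tau> w \<Longrightarrow> u = w"
  by (auto simp: identified_def inj_on_def)

text \<open>To become final, \<open>u\<close> needs the approval of every neighbour
  \<open>v\<close>. Such a \<open>v\<close> has heard the offers of all its neighbours and compared
  the offer of \<open>u\<close> with them and with its own colour. Nothing is assumed about which
  messages get through in this phase.\<close>

lemma newly_final_no_conflict:
  assumes id: "identified \<tau>" and p: "p < P"
    and None: "fnl \<tau> p u = None" and Some: "fnl \<tau> (Suc p) u \<noteq> None" and uv: "E u v"
  shows "clr \<tau> p u \<noteq> clr \<tau> p v" and "\<And>w. E v w \<Longrightarrow> w \<noteq> u \<Longrightarrow> clr \<tau> p u \<noteq> clr \<tau> p w"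
proof -
  have "\<forall>i\<in>nbrs (en \<tau> u). \<exists>xs. i # xs \<in> votes p (en \<tau> u) \<and> idt \<tau> u \<in> set xs"
    using None Some by (auto split: if_splits)
  moreover have "idt \<tau> v \<in> nbrs (en \<tau> u)" using uv by (simp add: nbrs_identified[OF id])
  ultimately obtain xs where xs: "idt \<tau> v # xs \<in> votes p (en \<tau> u)" "idt \<tau> u \<in> set xs" by blast
  then obtain v' where v': "hears_in \<tau> (phase p + l) (phase (Suc p)) u v'" "idt \<tau> v = idt \<tau> v'"
      "idt \<tau> u \<in> approvable p (tk \<tau> v') (en \<tau> v')"
    unfolding votes_en[OF p] by (auto simp: set_approved)
  \<comment> \<open>Identifiers are unique, so the vote carrying the identifier of \<open>v\<close>
    was cast by \<open>v\<close> itself.\<close>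
  have "v' = v" using idt_inj[OF id] hears_in_E[OF v'(1)] v'(2) uv E_V by metis
  then have ap: "idt \<tau> u \<in> approvable p (tk \<tau> v) (en \<tau> v)" using v' by simp
  have uV: "u \<in> V" using uv E_V by blast
  from ap obtain a where sub: "nbrs (en \<tau> v) \<subseteq> hd ` offers p (en \<tau> v)"
    and a: "[idt \<tau> u, a] \<in> offers p (en \<tau> v)" "a \<noteq> clr \<tau> p v"
    and other: "\<And>j a'. [j, a'] \<in> offers p (en \<tau> v) \<Longrightarrow> j \<noteq> idt \<tau> u \<Longrightarrow> a' \<noteq> a"
    by (auto simp: approvable_def)
  from a(1) obtain u' where "E v u'" "idt \<tau> u = idt \<tau> u'" "a = clr \<tau> p u'"
    unfolding offers_en[OF p] by (auto dest: hears_in_E)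
  then have a_eq: "a = clr \<tau> p u" using idt_inj[OF id] uV E_V by metis
  then show "clr \<tau> p u \<noteq> clr \<tau> p v" using a by simp
  fix w assume w: "E v w" "w \<noteq> u"
  then have "idt \<tau> w \<in> hd ` offers p (en \<tau> v)" using sub nbrs_identified[OF id] by blast
  then obtain w' where w': "hears_in \<tau> (phase p) (phase p + l) v w'" "idt \<tau> w = idt \<tau> w'"
    unfolding offers_en[OF p] by auto
  have "w' = w" using idt_inj[OF id] hears_in_E[OF w'(1)] w'(2) w E_V by metis
  then have "[idt \<tau> w, clr \<tau> p w] \<in> offers p (en \<tau> v)"
    using w' unfolding offers_en[OF p] by auto
  moreover have "idt \<tau> w \<noteq> idt \<tau> u" using idt_inj[OF id] w uV E_V by metis
  ultimately show "clr \<tau> p u \<noteq> clr \<tau> p w" using other[of "idt \<tau> w" "clr \<tau> p w"] a_eq by simp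
qed

lemma fnl_Suc_colour: "fnl \<tau> (Suc p) v = Some a \<Longrightarrow> clr \<tau> p v = a"
  by (auto simp: colour_def split: option.splits if_splits)

text \<open>Consider the phase in which the second of the two colours becomes final. By then the
  other vertex offers the colour it ends up with, either because it was final before or because it
  becomes final in the same phase, and the two offers were compared.\<close>

lemma final_distinct:
  assumes id: "identified \<tau>" and "p \<le> P" "fnl \<tau> p u = Some a" "fnl \<tau> p w = Some b"
    and "u \<noteq> w" and "E u w \<or> (E u v \<and> E v w)"
  shows "a \<noteq> b"
  using assms(2-)
proof (induction p arbitrary: u w a b)
  case (Suc p)
  have p: "p < P" using Suc.prems by simp
  have ab: "clr \<tau> p u = a" "clr \<tau> p w = b" using Suc.prems by (auto intro: fnl_Suc_colour)
  have rev: "E w u \<or> (E w v \<and> E v u)" using Suc.prems(5) sym by blast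
  consider "fnl \<tau> p u = None" | "fnl \<tau> p w = None" | "fnl \<tau> p u = Some a" "fnl \<tau> p w = Some b"
    using Suc.prems(2,3) by (auto split: option.splits)
  then show ?case
  proof cases
    case 1
    then have "clr \<tau> p u \<noteq> clr \<tau> p w"
      using newly_final_no_conflict[OF id p 1] Suc.prems by (metis option.distinct(1))
    then show ?thesis using ab by simp
  next
    case 2
    then have "clr \<tau> p w \<noteq> clr \<tau> p u"
      using newly_final_no_conflict[OF id p 2] Suc.prems rev by (metis option.distinct(1))
    then show ?thesis using ab by simp
  next
    case 3
    then show ?thesis using Suc by simp
  qed
qed simp

text \<open>All randomness is spent in the setup: on this event the rest of the simulation is
  deterministic and correct, so its complement bounds the total failure probability.\<close>

definition good :: "('v \<times> nat \<Rightarrow> nat) \<Rightarrow> bool" where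
  "good \<tau> \<longleftrightarrow> identified \<tau> \<and> (\<forall>v u. E v u \<longrightarrow> hears_in \<tau> (3 * S) (4 * S) v u) \<and>
     (\<forall>v\<in>V. fnl \<tau> P v \<noteq> None)"

lemma good_distinct:
  assumes "good \<tau>" "u \<noteq> w" "E u w \<or> (E u v \<and> E v w)"
  shows "clr \<tau> P u \<noteq> clr \<tau> P w"
proof -
  have "u \<in> V" "w \<in> V" using assms(3) E_V by blast+
  then obtain a b where ab: "fnl \<tau> P u = Some a" "fnl \<tau> P w = Some b"
    using assms(1) unfolding good_def by blast
  then have "a \<noteq> b" using final_distinct[OF _ order_refl ab assms(2,3)] assms(1) by (simp add: good_def)
  then show ?thesis using ab by (simp add: colour_def)
qed

lemma good_exchange:
  assumes "good \<tau>"
  shows "{a. \<exists>i. [i, a] \<in> heard (3 * S) (4 * S) (en \<tau> v)} = clr \<tau> P ` {u. E v u}"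
  using assms unfolding exchange_en good_def by (auto dest: hears_in_E)

lemma good_colour_less:
  assumes "good \<tau>" "v \<in> V" "\<And>p. p < P \<Longrightarrow> \<tau> (v, 4 * S + p) < M"
  shows "clr \<tau> P v < M"
proof -
  obtain a where a: "fnl \<tau> P v = Some a" using assms(1,2) unfolding good_def by blast
  then obtain q where "q < P" "a = cand q (tk \<tau> v)" using final_eq_Some_cand by blast
  then show ?thesis using a assms(3) by (simp add: colour_def cand_def)
qed

section \<open>Progress: what can keep a vertex uncoloured\<close>

definition conflict :: "nat \<Rightarrow> 'v \<Rightarrow> ('v \<times> nat \<Rightarrow> nat) \<Rightarrow> bool" where
  "conflict p v \<tau> \<longleftrightarrow> (\<exists>w. w \<noteq> v \<and> (E v w \<or> (\<exists>u. E v u \<and> E u w)) \<and> clr \<tau> p w = cand p (tk \<tau> v))"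

text \<open>This mentions neither \<open>identified\<close> nor whether \<open>v\<close> is still
  uncoloured, and \<open>conflict\<close> uses the fresh candidate in place of the current colour.
  The event can therefore be bounded without conditioning on how the run went so far.\<close>

definition phase_fails :: "nat \<Rightarrow> 'v \<Rightarrow> ('v \<times> nat \<Rightarrow> nat) \<Rightarrow> bool" where
  "phase_fails p v \<tau> \<longleftrightarrow> conflict p v \<tau> \<or>
     (\<exists>u. E v u \<and> \<not> hears_in \<tau> (phase p + l) (phase (Suc p)) v u) \<or>
     (\<exists>u w. E v u \<and> E u w \<and> \<not> hears_in \<tau> (phase p) (phase p + l) u w)"

text \<open>If \<open>v\<close> stays uncoloured, it lacks the approval of some neighbour
  \<open>u\<close>. Either the vote of \<open>u\<close> was lost, or \<open>u\<close> missed an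
  offer, or \<open>u\<close> saw a genuine conflict.\<close>

lemma phase_fails_if_not_final:
  assumes id: "identified \<tau>" and p: "p < P" and none: "fnl \<tau> (Suc p) v = None"
  shows "phase_fails p v \<tau>"
proof (rule ccontr)
  assume nf: "\<not> phase_fails p v \<tau>"
  have none': "fnl \<tau> p v = None" and
    "\<not> (\<forall>i\<in>nbrs (en \<tau> v). \<exists>xs. i # xs \<in> votes p (en \<tau> v) \<and> idt \<tau> v \<in> set xs)"
    using final_Suc_eq_NoneD[OF none] by auto
  then obtain u where u: "E v u"
    and no: "\<And>xs. idt \<tau> u # xs \<in> votes p (en \<tau> v) \<Longrightarrow> idt \<tau> v \<notin> set xs"
    unfolding nbrs_identified[OF id] by blast
  have "hears_in \<tau> (phase p + l) (phase (Suc p)) v u" using nf u by (auto simp: phase_fails_def)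
  then have "idt \<tau> v \<notin> approvable p (tk \<tau> u) (en \<tau> u)"
    using no[of "sorted_list_of_set (approvable p (tk \<tau> u) (en \<tau> u))"]
    unfolding votes_en[OF p] by (auto simp: set_approved)
  moreover have "idt \<tau> v \<in> approvable p (tk \<tau> u) (en \<tau> u)"
  proof -
    have hear: "hears_in \<tau> (phase p) (phase p + l) u w" if "E u w" for w
      using nf u that by (auto simp: phase_fails_def)
    have clr: "clr \<tau> p v = cand p (tk \<tau> v)" using none' by (simp add: colour_def)
    have noconf: "clr \<tau> p w \<noteq> clr \<tau> p v" if "w \<noteq> v" "E v w \<or> E u w" for w
      using nf u that unfolding phase_fails_def conflict_def clr by blast
    have "nbrs (en \<tau> u) \<subseteq> hd ` offers p (en \<tau> u)"
      unfolding nbrs_identified[OF id] offers_en[OF p] image_image using hear by auto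
    moreover have "[idt \<tau> v, clr \<tau> p v] \<in> offers p (en \<tau> u)"
      unfolding offers_en[OF p] using hear[OF sym[OF u]] by auto
    moreover have "clr \<tau> p v \<noteq> clr \<tau> p u" using noconf[of u] u irrefl by metis
    moreover have "a' \<noteq> clr \<tau> p v" if j: "[j, a'] \<in> offers p (en \<tau> u)" "j \<noteq> idt \<tau> v" for j a'
    proof -
      obtain w where "E u w" "j = idt \<tau> w" "a' = clr \<tau> p w"
        using j(1) unfolding offers_en[OF p] by (auto dest: hears_in_E)
      then show ?thesis using noconf[of w] j(2) by auto
    qed
    ultimately show ?thesis unfolding approvable_def by blast
  qed
  ultimately show False by contradiction
qed

lemma all_phases_fail:
  assumes "identified \<tau>" "fnl \<tau> P v = None" "p < P"
  shows "phase_fails p v \<tau>"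
proof -
  have "fnl \<tau> q v = None" if "q \<le> P" for q
    using that
  proof (induction q rule: inc_induct)
    case (step q)
    show ?case by (rule conjunct1[OF final_Suc_eq_NoneD[OF step.IH]])
  qed (rule assms(2))
  from this[of "Suc p"] show ?thesis
    using assms(3) by (intro phase_fails_if_not_final[OF assms(1,3)]) (simp del: final.simps)
qed

end

section \<open>Failure probability of the protocol\<close>

lemma of_bool_Bex_le_sum:
  assumes "finite X"
  shows "(of_bool (\<exists>x\<in>X. Q x) :: real) \<le> (\<Sum>x\<in>X. of_bool (Q x))"
proof (cases "\<exists>x\<in>X. Q x")
  case True
  then obtain x where "x \<in> X" "Q x" by blast
  then show ?thesis using member_le_sum[of x X "\<lambda>x. of_bool (Q x) :: real"] assms by simp
qed (simp add: sum_nonneg)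

lemma avg_Bex_le:
  fixes b :: real
  assumes "finite X" "\<And>x. x \<in> X \<Longrightarrow> avg M J (\<lambda>\<tau>. of_bool (Q x \<tau>)) \<tau> \<le> b"
  shows "avg M J (\<lambda>\<tau>. of_bool (\<exists>x\<in>X. Q x \<tau>)) \<tau> \<le> card X * b"
proof -
  have "avg M J (\<lambda>\<tau>. of_bool (\<exists>x\<in>X. Q x \<tau>)) \<tau> \<le> avg M J (\<lambda>\<tau>. \<Sum>x\<in>X. of_bool (Q x \<tau>)) \<tau>"
    by (intro avg_mono of_bool_Bex_le_sum assms)
  also have "\<dots> \<le> (\<Sum>x\<in>X. b)" unfolding avg_sum by (intro sum_mono assms)
  finally show ?thesis by simp
qed

lemma avg_of_bool_mono:
  "(\<And>\<tau>. A \<tau> \<Longrightarrow> B \<tau>) \<Longrightarrow> avg M J (\<lambda>\<tau>. of_bool (A \<tau>)) \<tau> \<le> avg M J (\<lambda>\<tau>. of_bool (B \<tau>)) \<tau>"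
  by (intro avg_mono) (simp add: of_bool_def)

lemma avg_disj_le:
  assumes "avg M J (\<lambda>\<tau>. of_bool (A \<tau>)) \<tau> \<le> a" "avg M J (\<lambda>\<tau>. of_bool (B \<tau>)) \<tau> \<le> b"
  shows "avg M J (\<lambda>\<tau>. of_bool (A \<tau> \<or> B \<tau>)) \<tau> \<le> a + b"
proof -
  have "avg M J (\<lambda>\<tau>. of_bool (A \<tau> \<or> B \<tau>)) \<tau> \<le> avg M J (\<lambda>\<tau>. of_bool (A \<tau>) + of_bool (B \<tau>)) \<tau>"
    by (intro avg_mono) auto
  then show ?thesis using assms by (simp add: avg_add)
qed

lemma avg_eq_token_le:
  assumes "j \<noteq> i"
  shows "avg M {i} (\<lambda>\<tau>. of_bool (\<tau> i = \<tau> j)) \<tau> \<le> 1 / real M"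
proof -
  have "(\<Sum>a<M. of_bool (a = \<tau> j) :: real) \<le> 1"
    by (simp add: of_bool_def)
  moreover have "avg M {i} (\<lambda>\<tau>. of_bool (\<tau> i = \<tau> j)) \<tau> = (\<Sum>a<M. of_bool (a = \<tau> j)) / real M"
    using assms by (simp add: avg_singleton)
  ultimately show ?thesis by (simp add: divide_right_mono)
qed

text \<open>By \<open>1 - y \<le> exp (- y)\<close> the power is at most \<open>exp (- 1)\<close>.
  Thus \<open>8 * \<Delta>\<close> slots halve the chance of missing a fixed neighbour; this is the
  unit in which \<open>l\<close> is measured.\<close>

lemma power_le_half:
  fixes \<Delta> :: nat
  assumes "\<Delta> > 0"
  shows "(1 - 1 / (8 * real \<Delta>)) ^ (8 * \<Delta>) \<le> 1 / 2"
proof -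
  have "(1 - 1 / (8 * real \<Delta>)) ^ (8 * \<Delta>) \<le> exp (- (1 / (8 * real \<Delta>))) ^ (8 * \<Delta>)"
    using assms exp_ge_add_one_self[of "- (1 / (8 * real \<Delta>))"]
    by (intro power_mono) (auto simp: field_simps)
  also have "\<dots> = exp (- 1)"
    using assms by (simp flip: exp_of_nat_mult)
  also have "\<dots> \<le> 1 / 2" using exp_ge_add_one_self[of 1] by (simp add: exp_minus field_simps)
  finally show ?thesis .
qed

text \<open>The choice of \<open>m\<close> gives \<open>2 ^ m = 8 * (2 ^ k) ^ 2\<close>, so the
  palette has at least \<open>8 * \<Delta> ^ 2\<close> colours and yet
  \<open>O(\<Delta> ^ 2)\<close> of them. A block of \<open>l\<close> slots consists of
  \<open>m\<close> halvings, so a message is lost in it with probability at most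
  \<open>1 / 2 ^ m\<close>, matching the probability of hitting one given colour.\<close>

locale random_network = network k l P V E
  for k l P :: nat and V :: "'v set" and E +
  fixes \<Delta> m :: nat
  assumes degree: "\<And>v. card {u. E v u} \<le> \<Delta>" and \<Delta>: "\<Delta> \<ge> 2" "\<Delta> \<le> 2 ^ k" "2 ^ k \<le> 2 * \<Delta>"
    and m: "m = 2 * k + 3" and l: "l = 8 * \<Delta> * m"
begin

abbreviation M :: nat where "M \<equiv> 2 ^ m"

abbreviation tokens :: "('v \<times> nat) set" where "tokens \<equiv> V \<times> {..<4 * S + P}"

lemma finite_nbhd: "finite {u. E v u}"
  by (rule finite_subset[OF _ fin]) (use E_V in auto)

lemma hears_cong: "(\<And>w. \<tau> (w, s) = \<tau>' (w, s)) \<Longrightarrow> hears \<tau> s v u = hears \<tau>' s v u"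
  by (simp add: hears_def coin_def)

lemma hears_in_cong:
  "(\<And>w s. a \<le> s \<Longrightarrow> s < b \<Longrightarrow> \<tau> (w, s) = \<tau>' (w, s)) \<Longrightarrow> hears_in \<tau> a b v u = hears_in \<tau>' a b v u"
  unfolding hears_in_def using hears_cong by metis

lemma not_hears_le:
  assumes "E v u"
  shows "avg M (V \<times> {s}) (\<lambda>\<tau>. of_bool (\<not> hears \<tau> s v u)) \<tau> \<le> 1 - 1 / (8 * real \<Delta>)"
proof (rule avg_le_superset)
  fix \<tau> :: "'v \<times> nat \<Rightarrow> nat"
  let ?N = "{w. E v w} - {u}"
  \<comment> \<open>The coins that must fail are those of the other neighbours and of the listener,
    which cannot receive while transmitting. The listener takes the place of the sender
    \<open>u\<close>, so there are still at most \<open>\<Delta>\<close> of them.\<close>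
  let ?W = "(\<lambda>w. (w, s)) ` insert v ?N"
  have uv: "u \<noteq> v" using assms irrefl by blast
  have "card ?W \<le> card (insert v ?N)" using finite_nbhd by (intro card_image_le) auto
  also have "\<dots> \<le> Suc (card ?N)" by (rule card_insert_le_m1) (auto simp: finite_nbhd)
  also have "\<dots> = card {w. E v w}" using assms finite_nbhd by (intro card.remove[symmetric]) auto
  finally have card: "card ?W \<le> \<Delta>" using degree[of v] by simp
  have eq: "hears \<tau> s v u \<longleftrightarrow> \<tau> (u, s) mod 2 ^ k = 0 \<and> (\<forall>i\<in>?W. \<tau> i mod 2 ^ k \<noteq> 0)" for \<tau>
    using assms by (auto simp: hears_def coin_def)
  have "1 / (8 * real \<Delta>) \<le> avg M (insert (u, s) ?W) (\<lambda>\<tau>. of_bool (hears \<tau> s v u)) \<tau>"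
    unfolding eq by (rule avg_single_coin_ge) (use card uv \<Delta> m finite_nbhd in auto)
  then show "avg M (insert (u, s) ?W) (\<lambda>\<tau>. of_bool (\<not> hears \<tau> s v u)) \<tau> \<le> 1 - 1 / (8 * real \<Delta>)"
    by (subst avg_not) (auto simp: finite_nbhd)
  show "insert (u, s) ?W \<subseteq> V \<times> {s}" using assms E_V by auto
qed (use fin in auto)

lemma not_hears_in_le:
  assumes "E v u"
  shows "avg M (V \<times> {a..<a + d}) (\<lambda>\<tau>. of_bool (\<not> hears_in \<tau> a (a + d) v u)) \<tau>
    \<le> (1 - 1 / (8 * real \<Delta>)) ^ d"
proof -
  have "(\<not> hears_in \<tau> a (a + d) v u) = (\<forall>p<d. \<not> hears \<tau> (a + p) v u)" for \<tau>
    unfolding hears_in_def by (metis add_less_cancel_left le_add1 le_iff_add)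
  moreover have "V \<times> {a..<a + d} = (\<Union>p<d. V \<times> {a + p})"
    by (auto simp: le_iff_add)
  moreover have "avg M (\<Union>p<d. V \<times> {a + p}) (\<lambda>\<tau>. of_bool (\<forall>p<d. \<not> hears \<tau> (a + p) v u)) \<tau>
      \<le> (1 - 1 / (8 * real \<Delta>)) ^ d"
  proof (rule avg_sequential_le)
    fix p q :: nat assume "q < p"
    then show "unaffected (V \<times> {a + p}) (\<lambda>\<tau>. \<not> hears \<tau> (a + q) v u)"
      unfolding unaffected_def by (intro allI impI arg_cong[where f = Not] hears_cong) auto
  qed (use fin \<Delta> not_hears_le[OF assms] in \<open>auto simp: field_simps\<close>)
  ultimately show ?thesis by simp
qed

lemma not_hears_in_block_le:
  assumes "E v u"
  shows "avg M (V \<times> {a..<a + l}) (\<lambda>\<tau>. of_bool (\<not> hears_in \<tau> a (a + l) v u)) \<tau> \<le> 1 / 2 ^ m"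
proof -
  have "((1 - 1 / (8 * real \<Delta>)) ^ (8 * \<Delta>)) ^ m \<le> (1 / 2) ^ m"
    using power_le_half[of \<Delta>] \<Delta> by (intro power_mono) (auto simp: field_simps)
  then have "(1 - 1 / (8 * real \<Delta>)) ^ l \<le> 1 / 2 ^ m"
    by (simp add: l power_mult power_one_over)
  then show ?thesis using not_hears_in_le[OF assms] order_trans by blast
qed

lemma not_hears_in_stage_le:
  assumes "E v u"
  shows "avg M (V \<times> {a..<a + S}) (\<lambda>\<tau>. of_bool (\<not> hears_in \<tau> a (a + S) v u)) \<tau> \<le> (1 / 2) ^ P"
proof -
  have S: "S = 8 * \<Delta> * (m * P)" unfolding S_def by (simp add: l)
  have "((1 - 1 / (8 * real \<Delta>)) ^ (8 * \<Delta>)) ^ (m * P) \<le> (1 / 2) ^ (m * P)"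
    using power_le_half[of \<Delta>] \<Delta> by (intro power_mono) (auto simp: field_simps)
  also have "\<dots> \<le> (1 / 2) ^ P" by (rule power_decreasing) (auto simp: m)
  finally have "(1 - 1 / (8 * real \<Delta>)) ^ S \<le> (1 / 2) ^ P"
    unfolding S power_mult[of _ "8 * \<Delta>" "m * P"] .
  then show ?thesis using not_hears_in_le[OF assms] order_trans by blast
qed

section \<open>Later tokens do not influence earlier phases\<close>

lemma ent_cong:
  assumes "p \<le> P" "\<And>w s. s < phase p \<Longrightarrow> \<tau> (w, s) = \<tau>' (w, s)"
    "\<And>w q. q < p \<Longrightarrow> \<tau> (w, 4 * S + q) = \<tau>' (w, 4 * S + q)" "s < phase p"
  shows "ent \<tau> s v = ent \<tau>' s v"
  using assms(4)
proof (induction s arbitrary: v rule: less_induct)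
  case (less s)
  have hears: "hears \<tau> s v u = hears \<tau>' s v u" for u
    using less.prems assms(2) by (intro hears_cong) auto
  have "phase p \<le> 3 * S" using phase_mono[OF assms(1)] by simp
  then have s: "s < 4 * S" using less.prems by linarith
  show ?case
  proof (cases "\<exists>u. hears \<tau> s v u")
    case True
    then obtain u where u: "hears \<tau> s v u" by blast
    have "setup_msg s (tk \<tau> u) (en \<tau> u) = setup_msg s (tk \<tau>' u) (en \<tau>' u)"
    proof (rule setup_msg_cong[OF s])
      show "ent \<tau> i u = ent \<tau>' i u" if "i < s" for i using less that by simp
      show "\<tau> (u, i) = \<tau>' (u, i)" if "i < S" for i
        using assms(2) that S_le_phase[of p] by simp
      show "cand q (tk \<tau> u) = cand q (tk \<tau>' u)" if "phase q \<le> s" for q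
      proof -
        have "q < p" using that less.prems phase_mono[of p q] by (cases "p \<le> q") auto
        then show ?thesis using assms(3) by (simp add: cand_def)
      qed
    qed
    then show ?thesis using ent_eq_Some'[OF _ s] u hears by metis
  qed (use hears ent_eq_None in metis)
qed

lemma clr_cong:
  assumes "p \<le> P" "\<And>w s. s < phase p \<Longrightarrow> \<tau> (w, s) = \<tau>' (w, s)"
    "\<And>w q. q < p \<Longrightarrow> \<tau> (w, 4 * S + q) = \<tau>' (w, 4 * S + q)"
    "\<tau> (v, 4 * S + p) = \<tau>' (v, 4 * S + p)"
  shows "clr \<tau> p v = clr \<tau>' p v"
proof (rule colour_cong)
  show "ent \<tau> i v = ent \<tau>' i v" if "i < phase p" for i
    using assms that by (intro ent_cong) auto
  show "\<tau> (v, i) = \<tau>' (v, i)" if "i < S" for i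
    using assms(2) that S_le_phase[of p] by simp
  show "cand q (tk \<tau> v) = cand q (tk \<tau>' v)" if "q \<le> p" for q
    using assms(3)[of q v] assms(4) that by (cases "q = p") (auto simp: cand_def)
qed

lemma phase_fails_cong:
  assumes "p < P" "\<And>w s. s < phase (Suc p) \<Longrightarrow> \<tau> (w, s) = \<tau>' (w, s)"
    "\<And>w q. q \<le> p \<Longrightarrow> \<tau> (w, 4 * S + q) = \<tau>' (w, 4 * S + q)"
  shows "phase_fails p v \<tau> = phase_fails p v \<tau>'"
proof -
  have "clr \<tau> p w = clr \<tau>' p w" for w
    by (rule clr_cong) (use assms in \<open>auto simp: phase_Suc\<close>)
  moreover have "cand p (tk \<tau> v) = cand p (tk \<tau>' v)" using assms(3) by (simp add: cand_def)
  moreover have "hears_in \<tau> (phase p) (phase p + l) u w = hears_in \<tau>' (phase p) (phase p + l) u w"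
    and "hears_in \<tau> (phase p + l) (phase (Suc p)) u w = hears_in \<tau>' (phase p + l) (phase (Suc p)) u w"
    for u w
    by (rule hears_in_cong; use assms(2) in \<open>simp add: phase_Suc\<close>)+
  ultimately show ?thesis by (simp add: phase_fails_def conflict_def)
qed

text \<open>Deferred decisions: the candidate of \<open>v\<close> is drawn last. The current colours
  of the other vertices do not depend on it, and at most
  \<open>\<Delta> + \<Delta> * \<Delta>\<close> vertices within distance two forbid a value.\<close>

lemma conflict_le:
  assumes "p < P"
  shows "avg M {(v, 4 * S + p)} (\<lambda>\<tau>. of_bool (conflict p v \<tau>)) \<tau> \<le> 2 * real \<Delta> ^ 2 / 2 ^ m"
proof -
  let ?X = "{w. w \<noteq> v \<and> (E v w \<or> (\<exists>u. E v u \<and> E u w))}"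
  let ?Y = "{w. E v w} \<union> (\<Union>u\<in>{u. E v u}. {w. E u w})"
  have finY: "finite ?Y" using finite_nbhd by auto
  have "phase p \<le> 3 * S" using phase_mono[of p P] assms by simp
  then have clr: "clr (\<tau>((v, 4 * S + p) := a)) p w = clr \<tau> p w" if "w \<noteq> v" for w a
    using assms that by (intro clr_cong) auto
  have "card ?X \<le> card ?Y" using finY by (intro card_mono) auto
  also have "\<dots> \<le> \<Delta> + (\<Sum>u\<in>{u. E v u}. card {w. E u w})"
    using degree[of v] finite_nbhd by (intro order_trans[OF card_Un_le] add_mono card_UN_le) auto
  also have "\<dots> \<le> \<Delta> + (\<Sum>u\<in>{u. E v u}. \<Delta>)" by (intro add_mono sum_mono degree) auto
  also have "\<dots> \<le> \<Delta> * \<Delta> + \<Delta> * \<Delta>" using degree[of v] \<Delta>(1) by (intro add_mono) auto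
  finally have cardX: "card ?X \<le> 2 * (\<Delta> * \<Delta>)" by simp
  have finX: "finite ?X" using finY by (rule finite_subset[rotated]) auto
  have "(\<Sum>a<M. of_bool (conflict p v (\<tau>((v, 4 * S + p) := a))))
      \<le> (\<Sum>a<M. of_bool (a \<in> clr \<tau> p ` ?X) :: real)"
  proof (rule sum_mono)
    fix a
    have "a \<in> clr \<tau> p ` ?X" if conf: "conflict p v (\<tau>((v, 4 * S + p) := a))"
    proof -
      obtain w where w: "w \<in> ?X"
          "clr (\<tau>((v, 4 * S + p) := a)) p w = cand p (tk (\<tau>((v, 4 * S + p) := a)) v)"
        using conf unfolding conflict_def by blast
      moreover have "cand p (tk (\<tau>((v, 4 * S + p) := a)) v) = a" by (simp add: cand_def)
      ultimately have "a = clr \<tau> p w" using clr[of w a] by simp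
      then show ?thesis using w(1) by blast
    qed
    then show "of_bool (conflict p v (\<tau>((v, 4 * S + p) := a))) \<le> (of_bool (a \<in> clr \<tau> p ` ?X) :: real)"
      by simp
  qed
  also have "\<dots> = real (card ({..<M} \<inter> clr \<tau> p ` ?X))"
    by (subst sum_of_bool_eq) (auto intro!: arg_cong[where f = card])
  also have "\<dots> \<le> real (card (clr \<tau> p ` ?X))"
    using finX by (intro of_nat_mono card_mono) auto
  also have "\<dots> \<le> real (card ?X)" using finX by (intro of_nat_mono card_image_le)
  also have "\<dots> \<le> real (2 * (\<Delta> * \<Delta>))" using cardX by (rule of_nat_mono)
  finally show ?thesis
    by (simp add: avg_singleton divide_right_mono power2_eq_square)
qed

section \<open>Failure probabilities of a phase and of the whole setup\<close>

definition phase_tokens :: "nat \<Rightarrow> ('v \<times> nat) set" where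
  "phase_tokens p = V \<times> ({phase p..<phase (Suc p)} \<union> {4 * S + p})"

text \<open>A union bound with terms of \<open>1 / 2 ^ m\<close> each:
  \<open>2 * \<Delta> ^ 2\<close> for forbidden colours, \<open>\<Delta>\<close> for votes that
  \<open>v\<close> must hear and \<open>\<Delta> ^ 2\<close> for offers that its neighbours must
  hear. The sum is at most \<open>4 * \<Delta> ^ 2 / 2 ^ m\<close>, and \<open>2 ^ m\<close> is at
  least \<open>8 * \<Delta> ^ 2\<close>. That \<open>\<tau>\<close> is arbitrary means that the
  bound holds given any past.\<close>

lemma phase_fails_le:
  assumes p: "p < P" and v: "v \<in> V"
  shows "avg M (phase_tokens p) (\<lambda>\<tau>. of_bool (phase_fails p v \<tau>)) \<tau> \<le> 1 / 2"
proof -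
  let ?J = "phase_tokens p"
  have finJ: "finite ?J" using fin by (simp add: phase_tokens_def)
  have conf: "avg M ?J (\<lambda>\<tau>. of_bool (conflict p v \<tau>)) \<tau> \<le> 2 * real \<Delta> ^ 2 / 2 ^ m"
    by (rule avg_le_superset[OF conflict_le[OF p]]) (use v finJ in \<open>auto simp: phase_tokens_def\<close>)
  have votes: "avg M ?J (\<lambda>\<tau>. of_bool (\<not> hears_in \<tau> (phase p + l) (phase (Suc p)) v u)) \<tau> \<le> 1 / 2 ^ m"
    if "E v u" for u
  proof (rule avg_le_superset)
    have [simp]: "phase (Suc p) = phase p + l + l" by (simp add: phase_Suc)
    show "avg M (V \<times> {phase p + l..<phase p + l + l})
        (\<lambda>\<tau>. of_bool (\<not> hears_in \<tau> (phase p + l) (phase (Suc p)) v u)) \<tau> \<le> 1 / 2 ^ m" for \<tau>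
      using not_hears_in_block_le[OF that, of "phase p + l"] by simp
  qed (use finJ in \<open>auto simp: phase_tokens_def phase_Suc\<close>)
  have offers: "avg M ?J (\<lambda>\<tau>. of_bool (\<not> hears_in \<tau> (phase p) (phase p + l) u w)) \<tau> \<le> 1 / 2 ^ m"
    if "E u w" for u w
    by (rule avg_le_superset[OF not_hears_in_block_le[OF that]])
      (use finJ in \<open>auto simp: phase_tokens_def phase_Suc\<close>)
  let ?F = "\<lambda>\<tau>. \<exists>u\<in>{u. E v u}. \<not> hears_in \<tau> (phase p + l) (phase (Suc p)) v u"
  let ?G = "\<lambda>\<tau>. \<exists>u\<in>{u. E v u}. \<exists>w\<in>{w. E u w}. \<not> hears_in \<tau> (phase p) (phase p + l) u w"
  have "avg M ?J (\<lambda>\<tau>. of_bool (?F \<tau>)) \<tau> \<le> card {u. E v u} * (1 / 2 ^ m)"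
    using votes finite_nbhd by (intro avg_Bex_le) auto
  also have "\<dots> \<le> real \<Delta> * (1 / 2 ^ m)" using degree by (intro mult_right_mono) auto
  finally have F: "avg M ?J (\<lambda>\<tau>. of_bool (?F \<tau>)) \<tau> \<le> real \<Delta> / 2 ^ m" by simp
  have "avg M ?J (\<lambda>\<tau>. of_bool (?G \<tau>)) \<tau> \<le> card {u. E v u} * (real \<Delta> * (1 / 2 ^ m))"
  proof (intro avg_Bex_le finite_nbhd)
    fix u
    have "avg M ?J (\<lambda>\<tau>. of_bool (\<exists>w\<in>{w. E u w}. \<not> hears_in \<tau> (phase p) (phase p + l) u w)) \<tau>
        \<le> card {w. E u w} * (1 / 2 ^ m)"
      using offers finite_nbhd by (intro avg_Bex_le) auto
    also have "\<dots> \<le> real \<Delta> * (1 / 2 ^ m)" using degree by (intro mult_right_mono) auto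
    finally show "avg M ?J (\<lambda>\<tau>. of_bool (\<exists>w\<in>{w. E u w}. \<not> hears_in \<tau> (phase p) (phase p + l) u w)) \<tau>
        \<le> real \<Delta> * (1 / 2 ^ m)" .
  qed
  also have "\<dots> \<le> real \<Delta> * (real \<Delta> * (1 / 2 ^ m))" using degree by (intro mult_right_mono) auto
  finally have G: "avg M ?J (\<lambda>\<tau>. of_bool (?G \<tau>)) \<tau> \<le> real \<Delta> ^ 2 / 2 ^ m"
    by (simp add: power2_eq_square)
  have "phase_fails p v \<tau> \<longleftrightarrow> conflict p v \<tau> \<or> ?F \<tau> \<or> ?G \<tau>" for \<tau>
    by (auto simp: phase_fails_def)
  then have "avg M ?J (\<lambda>\<tau>. of_bool (phase_fails p v \<tau>)) \<tau>
      \<le> 2 * real \<Delta> ^ 2 / 2 ^ m + (real \<Delta> / 2 ^ m + real \<Delta> ^ 2 / 2 ^ m)"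
    using avg_disj_le[OF conf avg_disj_le[OF F G]] by simp
  also have "\<dots> = (3 * real \<Delta> ^ 2 + real \<Delta>) / 2 ^ m" by (simp add: add_divide_distrib)
  also have "\<dots> \<le> 4 * real \<Delta> ^ 2 / 2 ^ m"
    using \<Delta>(1) by (intro divide_right_mono) (auto simp: power2_eq_square)
  also have "\<dots> \<le> 1 / 2"
  proof -
    have "real \<Delta> \<le> 2 ^ k" using \<Delta>(2) by (metis of_nat_le_iff of_nat_numeral of_nat_power)
    then have "real \<Delta> ^ 2 \<le> (2 ^ k) ^ 2" by (intro power_mono) auto
    also have "(2 ^ k) ^ 2 * 8 = (2 ^ m :: real)"
      unfolding m by (simp add: power_add power_mult mult.commute)
    finally show ?thesis by (simp add: field_simps)
  qed
  finally show ?thesis .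
qed

text \<open>Phases are not independent, because colours persist, but each one has conditional
  failure probability at most \<open>1 / 2\<close>, which is all that
  \<open>avg_sequential_le\<close> asks for.\<close>

lemma never_final_le:
  assumes v: "v \<in> V"
  shows "avg M tokens (\<lambda>\<tau>. of_bool (\<forall>p<P. phase_fails p v \<tau>)) \<tau> \<le> (1 / 2) ^ P"
proof (rule avg_le_superset)
  show "avg M (\<Union>p<P. phase_tokens p) (\<lambda>\<tau>. of_bool (\<forall>p<P. phase_fails p v \<tau>)) \<tau> \<le> (1 / 2) ^ P" for \<tau>
  proof (rule avg_sequential_le)
    fix p q assume pq: "q < p" "p < P"
    have ph: "phase (Suc q) \<le> phase p" "phase (Suc p) \<le> 3 * S"
      using pq phase_mono[of "Suc q" p] phase_Suc_le by auto
    show "phase_tokens q \<inter> phase_tokens p = {}"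
      using pq ph phase_Suc_le[of q] by (auto simp: phase_tokens_def)
    show "unaffected (phase_tokens p) (phase_fails q v)"
      unfolding unaffected_def
    proof (intro allI impI)
      fix \<tau> \<tau>' :: "'v \<times> nat \<Rightarrow> nat"
      assume agree: "\<forall>i. i \<notin> phase_tokens p \<longrightarrow> \<tau> i = \<tau>' i"
      show "phase_fails q v \<tau> = phase_fails q v \<tau>'"
      proof (rule phase_fails_cong)
        show "\<tau> (w, s) = \<tau>' (w, s)" if "s < phase (Suc q)" for w s
          using agree that ph phase_mono[of "Suc q" P] pq by (auto simp: phase_tokens_def)
        show "\<tau> (w, 4 * S + q') = \<tau>' (w, 4 * S + q')" if "q' \<le> q" for w q'
          using agree that ph pq by (auto simp: phase_tokens_def)
      qed (use pq in simp)
    qed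
  qed (use fin phase_fails_le v in \<open>auto simp: phase_tokens_def\<close>)
  show "(\<Union>p<P. phase_tokens p) \<subseteq> tokens"
  proof -
    have "phase_tokens p \<subseteq> tokens" if "p < P" for p
      using phase_Suc_le[OF that] that by (auto simp: phase_tokens_def)
    then show ?thesis by blast
  qed
qed (use fin in auto)

text \<open>With the tokens of \<open>v\<close> held fixed, each of the first \<open>S\<close>
  tokens of \<open>u\<close> has to hit a prescribed value.\<close>

lemma same_ident_le:
  assumes "u \<in> V" "u \<noteq> v"
  shows "avg M tokens (\<lambda>\<tau>. of_bool (idt \<tau> u = idt \<tau> v)) \<tau> \<le> (1 / 2) ^ P"
proof (rule avg_le_superset)
  fix \<tau> :: "'v \<times> nat \<Rightarrow> nat"
  have "avg M (\<Union>i<S. {(u, i)}) (\<lambda>\<tau>. of_bool (idt \<tau> u = idt \<tau> v)) \<tau>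
      \<le> avg M (\<Union>i<S. {(u, i)}) (\<lambda>\<tau>. of_bool (\<forall>i<S. \<tau> (u, i) = \<tau> (v, i))) \<tau>"
    by (rule avg_of_bool_mono) (blast dest: ident_eqD)
  also have "\<dots> \<le> (1 / 2) ^ S"
  proof (rule avg_sequential_le)
    fix p \<tau>
    have "avg M {(u, p)} (\<lambda>\<tau>. of_bool (\<tau> (u, p) = \<tau> (v, p))) \<tau> \<le> 1 / real M"
      using assms by (intro avg_eq_token_le) auto
    also have "\<dots> = (1 / 2) ^ m" by (simp add: power_one_over)
    also have "\<dots> \<le> (1 / 2) ^ 1" by (rule power_decreasing) (auto simp: m)
    finally show "avg M {(u, p)} (\<lambda>\<tau>. of_bool (\<tau> (u, p) = \<tau> (v, p))) \<tau> \<le> 1 / 2" by simp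
  qed (use assms in \<open>auto simp: unaffected_def\<close>)
  also have "\<dots> \<le> (1 / 2) ^ P"
    using \<Delta>(1) unfolding S_def by (intro power_decreasing) (auto simp: l m)
  finally show "avg M (\<Union>i<S. {(u, i)}) (\<lambda>\<tau>. of_bool (idt \<tau> u = idt \<tau> v)) \<tau> \<le> (1 / 2) ^ P" .
qed (use assms fin in auto)

text \<open>Four kinds of failure (equal identifiers, a gap in discovery, a gap in the final
  exchange, a vertex that never becomes final) have at most \<open>card V ^ 2\<close> instances
  each. Identifiers and discovery coins are the same tokens, but a union bound does not mind;
  \<open>identified\<close> is used only as a hypothesis of \<open>all_phases_fail\<close>, never as
  a condition in a probability.\<close>

lemma not_good_le:
  "avg M tokens (\<lambda>\<tau>. of_bool (\<not> good \<tau>)) \<tau> \<le> 4 * real (card V) ^ 2 * (1 / 2) ^ P"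
proof -
  let ?n = "real (card V)"
  let ?A = "\<lambda>\<tau>. \<exists>x\<in>{x \<in> V \<times> V. fst x \<noteq> snd x}. idt \<tau> (fst x) = idt \<tau> (snd x)"
  let ?B = "\<lambda>a \<tau>. \<exists>x\<in>{x \<in> V \<times> V. E (fst x) (snd x)}. \<not> hears_in \<tau> a (a + S) (fst x) (snd x)"
  let ?C = "\<lambda>\<tau>. \<exists>v\<in>V. \<forall>p<P. phase_fails p v \<tau>"
  have pairs: "real (card {x \<in> V \<times> V. Q x}) \<le> ?n ^ 2" for Q
  proof -
    have "card {x \<in> V \<times> V. Q x} \<le> card (V \<times> V)" using fin by (intro card_mono) auto
    then show ?thesis by (simp add: card_cartesian_product power2_eq_square flip: of_nat_mult)
  qed
  have "avg M tokens (\<lambda>\<tau>. of_bool (?A \<tau>)) \<tau> \<le> card {x \<in> V \<times> V. fst x \<noteq> snd x} * (1 / 2) ^ P"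
    using fin same_ident_le by (intro avg_Bex_le) auto
  also have "\<dots> \<le> ?n ^ 2 * (1 / 2) ^ P" by (intro mult_right_mono pairs) auto
  finally have A: "avg M tokens (\<lambda>\<tau>. of_bool (?A \<tau>)) \<tau> \<le> ?n ^ 2 * (1 / 2) ^ P" .
  have B: "avg M tokens (\<lambda>\<tau>. of_bool (?B a \<tau>)) \<tau> \<le> ?n ^ 2 * (1 / 2) ^ P" if "a + S \<le> 4 * S" for a
  proof -
    have "avg M tokens (\<lambda>\<tau>. of_bool (\<not> hears_in \<tau> a (a + S) v u)) \<tau> \<le> (1 / 2) ^ P" if "E v u" for v u
      by (rule avg_le_superset[OF not_hears_in_stage_le[OF that]]) (use \<open>a + S \<le> 4 * S\<close> fin in auto)
    then have "avg M tokens (\<lambda>\<tau>. of_bool (?B a \<tau>)) \<tau>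
        \<le> card {x \<in> V \<times> V. E (fst x) (snd x)} * (1 / 2) ^ P"
      using fin by (intro avg_Bex_le) auto
    also have "\<dots> \<le> ?n ^ 2 * (1 / 2) ^ P" by (intro mult_right_mono pairs) auto
    finally show ?thesis .
  qed
  have "avg M tokens (\<lambda>\<tau>. of_bool (?C \<tau>)) \<tau> \<le> card V * (1 / 2) ^ P"
    using fin never_final_le by (intro avg_Bex_le) auto
  also have "\<dots> \<le> ?n ^ 2 * (1 / 2) ^ P"
    using self_le_power[of ?n 2] by (intro mult_right_mono) (cases "card V", auto)
  finally have C: "avg M tokens (\<lambda>\<tau>. of_bool (?C \<tau>)) \<tau> \<le> ?n ^ 2 * (1 / 2) ^ P" .
  have "?A \<tau> \<or> ?B 0 \<tau> \<or> ?B (3 * S) \<tau> \<or> ?C \<tau>" if not_good: "\<not> good \<tau>" for \<tau>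
  proof -
    have eq: "3 * S + S = 4 * S" by simp
    have "\<not> inj_on (idt \<tau>) V \<or> (\<exists>v u. E v u \<and> \<not> hears_in \<tau> 0 S v u) \<or>
        (\<exists>v u. E v u \<and> \<not> hears_in \<tau> (3 * S) (4 * S) v u) \<or>
        (identified \<tau> \<and> (\<exists>v\<in>V. fnl \<tau> P v = None))"
      using not_good by (auto simp: good_def identified_def)
    then consider (ids) u v where "u \<in> V" "v \<in> V" "u \<noteq> v" "idt \<tau> u = idt \<tau> v"
      | (discovery) v u where "E v u" "\<not> hears_in \<tau> 0 S v u"
      | (exchange) v u where "E v u" "\<not> hears_in \<tau> (3 * S) (4 * S) v u"
      | (final) v where "identified \<tau>" "v \<in> V" "fnl \<tau> P v = None"
      by (elim disjE) (auto simp: inj_on_def)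
    then show ?thesis
    proof cases
      case ids
      then have "?A \<tau>" by (intro bexI[of _ "(u, v)"]) auto
      then show ?thesis by blast
    next
      case discovery
      then have "?B 0 \<tau>" using E_V by (intro bexI[of _ "(v, u)"]) auto
      then show ?thesis by blast
    next
      case exchange
      then have "?B (3 * S) \<tau>" unfolding eq using E_V by (intro bexI[of _ "(v, u)"]) auto
      then show ?thesis by blast
    next
      case final
      then have "?C \<tau>" using all_phases_fail by blast
      then show ?thesis by blast
    qed
  qed
  then have "avg M tokens (\<lambda>\<tau>. of_bool (\<not> good \<tau>)) \<tau>
      \<le> avg M tokens (\<lambda>\<tau>. of_bool (?A \<tau> \<or> ?B 0 \<tau> \<or> ?B (3 * S) \<tau> \<or> ?C \<tau>)) \<tau>"
    by (rule avg_of_bool_mono)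
  also have "\<dots> \<le> ?n ^ 2 * (1 / 2) ^ P + (?n ^ 2 * (1 / 2) ^ P + (?n ^ 2 * (1 / 2) ^ P + ?n ^ 2 * (1 / 2) ^ P))"
    by (intro avg_disj_le A B C) auto
  finally show ?thesis by (simp add: algebra_simps)
qed

end

section \<open>From random bits to tokens\<close>

text \<open>The clause \<open>G [] = (\<lambda>_. undefined)\<close> makes the decoded assignment of tokens extensional, since
  vertices outside of the graph have no random bits.\<close>

lemma ex_decoder:
  assumes "N * m > 0"
  obtains G :: "bool list \<Rightarrow> nat \<Rightarrow> nat"
  where "bij_betw G {bs. length bs = N * m} ({..<N} \<rightarrow>\<^sub>E {..<2 ^ m})" "G [] = (\<lambda>_. undefined)"
proof -
  let ?A = "{bs :: bool list. length bs = N * m}" and ?B = "{..<N} \<rightarrow>\<^sub>E {..<(2::nat) ^ m}"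
  have A: "?A = {bs. set bs \<subseteq> UNIV \<and> length bs = N * m}" by simp
  have "card ?A = 2 ^ (N * m)" unfolding A by (subst card_lists_length_eq) simp_all
  moreover have "card ?B = 2 ^ (N * m)" by (simp add: card_PiE mult.commute flip: power_mult)
  moreover have "finite ?A" unfolding A by (rule finite_lists_length_eq) simp
  moreover have "finite ?B" by (simp add: finite_PiE)
  ultimately obtain G where G: "bij_betw G ?A ?B" using finite_same_card_bij by metis
  \<comment> \<open>The length \<open>N * m\<close> is positive, so \<open>[]\<close> lies outside
    of the domain and its value can be chosen freely.\<close>
  have "bij_betw (G([] := (\<lambda>_. undefined))) ?A ?B \<longleftrightarrow> bij_betw G ?A ?B"
    using assms by (intro bij_betw_cong) auto
  then show ?thesis using G that[of "G([] := (\<lambda>_. undefined))"] by simp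
qed

definition decode :: "(bool list \<Rightarrow> nat \<Rightarrow> nat) \<Rightarrow> ('v \<Rightarrow> bool list) \<Rightarrow> 'v \<times> nat \<Rightarrow> nat" where
  "decode G r = (\<lambda>(v, i). G (r v) i)"

lemma bij_betw_decode:
  fixes V :: "'v set"
  assumes G: "bij_betw G {bs. length bs = L} ({..<N} \<rightarrow>\<^sub>E {..<M})" and Nil: "G [] = (\<lambda>_. undefined)"
  shows "bij_betw (decode G) (rand_assign V L) (V \<times> {..<N} \<rightarrow>\<^sub>E {..<M})"
proof (rule bij_betw_imageI)
  let ?A = "{bs. length bs = L}" and ?B = "{..<N} \<rightarrow>\<^sub>E {..<M}"
  have inj: "inj_on G ?A" and img: "G ` ?A = ?B" using G by (auto simp: bij_betw_def)
  show "inj_on (decode G) (rand_assign V L)"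
  proof (rule inj_onI, rule ext)
    fix r r' v assume r: "r \<in> rand_assign V L" "r' \<in> rand_assign V L" "decode G r = decode G r'"
    have "G (r v) = G (r' v)"
      using fun_cong[OF r(3), of "(v, _)"] by (simp add: decode_def fun_eq_iff)
    then show "r v = r' v"
      using r(1,2) inj_onD[OF inj, of "r v" "r' v"] by (cases "v \<in> V") (auto simp: rand_assign_def)
  qed
  show "decode G ` rand_assign V L = V \<times> {..<N} \<rightarrow>\<^sub>E {..<M}"
  proof (intro equalityI subsetI)
    fix \<tau> assume "\<tau> \<in> decode G ` rand_assign V L"
    then obtain r where r: "r \<in> rand_assign V L" and \<tau>: "\<tau> = decode G r" by blast
    have "G (r v) \<in> ?B" if "v \<in> V" for v
      using r that img by (auto simp: rand_assign_def)
    moreover have "G (r v) = (\<lambda>_. undefined)" if "v \<notin> V" for v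
      using r that Nil by (simp add: rand_assign_def)
    ultimately show "\<tau> \<in> V \<times> {..<N} \<rightarrow>\<^sub>E {..<M}"
      unfolding \<tau> decode_def PiE_iff extensional_def by (auto simp: Pi_iff; metis)
  next
    fix \<tau> assume \<tau>: "\<tau> \<in> V \<times> {..<N} \<rightarrow>\<^sub>E {..<M}"
    define r where "r v = (if v \<in> V then inv_into ?A G (\<lambda>i. \<tau> (v, i)) else [])" for v
    have "(\<lambda>i. \<tau> (v, i)) \<in> G ` ?A" if "v \<in> V" for v
      unfolding img using \<tau> that by (auto simp: PiE_iff extensional_def)
    then have r: "r v \<in> ?A" "G (r v) = (\<lambda>i. \<tau> (v, i))" if "v \<in> V" for v
      using that inv_into_into[of _ G ?A] f_inv_into_f[of _ G ?A] by (simp_all add: r_def)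
    have "decode G r p = \<tau> p" for p
    proof (cases p)
      case (Pair v i)
      show ?thesis
        using r(2)[of v] Nil \<tau> by (cases "v \<in> V") (auto simp: Pair decode_def r_def PiE_iff extensional_def)
    qed
    moreover have "r \<in> rand_assign V L" using r(1) by (auto simp: rand_assign_def r_def)
    ultimately show "\<tau> \<in> decode G ` rand_assign V L" by (metis ext image_eqI)
  qed
qed

text \<open>Decoding is a bijection and so preserves the uniform distribution: averages over tokens
  are proportions of random bit assignments.\<close>

lemma card_bad_assign_le:
  fixes V :: "'v set" and \<delta> :: real
  assumes G: "bij_betw G {bs. length bs = L} ({..<N} \<rightarrow>\<^sub>E {..<M})" "G [] = (\<lambda>_. undefined)"
    and fin: "finite V" and M: "M > 0"
    and avg: "\<And>\<tau>. avg M (V \<times> {..<N}) (\<lambda>\<tau>. of_bool (B \<tau>)) \<tau> \<le> \<delta>"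
    and bad: "\<And>r. r \<in> rand_assign V L \<Longrightarrow> bad r \<Longrightarrow> B (decode G r)"
  shows "real (card {r \<in> rand_assign V L. bad r}) \<le> real (card (rand_assign V L)) * \<delta>"
proof -
  let ?I = "V \<times> {..<N}"
  let ?\<Omega> = "?I \<rightarrow>\<^sub>E {..<M}"
  have finI: "finite ?I" using fin by simp
  have fin\<Omega>: "finite ?\<Omega>" using finI by (simp add: finite_PiE)
  have D: "inj_on (decode G) (rand_assign V L)" "decode G ` rand_assign V L = ?\<Omega>"
    using bij_betw_decode[OF G, of V] by (auto simp: bij_betw_def)
  have "card (rand_assign V L) = card ?\<Omega>" using D card_image by metis
  also have "\<dots> = M ^ card ?I" using finI by (simp add: card_PiE)
  finally have card: "real (card (rand_assign V L)) = real M ^ card ?I" by simp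
  have "card {r \<in> rand_assign V L. bad r} \<le> card {\<tau> \<in> ?\<Omega>. B \<tau>}"
  proof (rule card_inj_on_le)
    show "inj_on (decode G) {r \<in> rand_assign V L. bad r}" using D(1) by (rule inj_on_subset) auto
    show "decode G ` {r \<in> rand_assign V L. bad r} \<subseteq> {\<tau> \<in> ?\<Omega>. B \<tau>}" using D(2) bad by blast
  qed (use fin\<Omega> in auto)
  then have "real (card {r \<in> rand_assign V L. bad r}) \<le> real (card {\<tau> \<in> ?\<Omega>. B \<tau>})" by simp
  also have "\<dots> = real M ^ card ?I * avg M ?I (\<lambda>\<tau>. of_bool (B \<tau>)) (\<lambda>_. undefined)"
    using M unfolding avg_of_bool_eq_card[OF finI] by simp
  also have "\<dots> \<le> real M ^ card ?I * \<delta>" by (intro mult_left_mono avg) auto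
  finally show ?thesis by (simp add: card)
qed

section \<open>The executable setup and its agreement with the token-level run\<close>

context setup_params
begin

definition past :: "'m sim_msg option list \<Rightarrow> nat \<Rightarrow> nat list option" where
  "past h = (\<lambda>i. if i < length h then map_option snd (h ! i) else None)"

text \<open>No vertex is ever idle here; being awake for all \<open>4 * S\<close> slots is within
  the energy bound.\<close>

definition setup_dec :: "(bool list \<Rightarrow> nat \<Rightarrow> nat) \<Rightarrow> bool list \<Rightarrow> 'm sim_msg option list \<Rightarrow> 'm sim_msg actB" where
  "setup_dec G r h = (if coin (G r) (length h)
     then BTransmit ([], setup_msg (length h) (G r) (past h)) else BListen)"

definition own_colour :: "(bool list \<Rightarrow> nat \<Rightarrow> nat) \<Rightarrow> bool list \<Rightarrow> 'm sim_msg option list \<Rightarrow> nat" where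
  "own_colour G r h = colour P (G r) (past h)"

definition nbr_colours :: "bool list \<Rightarrow> 'm sim_msg option list \<Rightarrow> nat set" where
  "nbr_colours r h = {a. \<exists>i. [i, a] \<in> heard (3 * S) (4 * S) (past h)}"

definition full_act :: "(nat \<Rightarrow> 's \<Rightarrow> 'm option \<times> bool) \<Rightarrow> (nat \<Rightarrow> 's \<Rightarrow> 'm multiset \<Rightarrow> 's) \<Rightarrow> nat
    \<Rightarrow> (bool list \<Rightarrow> nat \<Rightarrow> nat) \<Rightarrow> 's \<Rightarrow> bool list \<Rightarrow> 'm sim_msg option list \<Rightarrow> 'm sim_msg actB" where
  "full_act act upd M G = sim_act act upd (4 * S) M (setup_dec G) (own_colour G) nbr_colours"

end

context network
begin

text \<open>The coins decide who transmits in either description, so the same receptions occur; by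
  induction a sender finds in its history exactly the earlier values of \<open>ent\<close>, and
  hence sends the same message.\<close>

lemma nocd_entry_setup:
  "s < 4 * S \<Longrightarrow>
    nocd_entry E (full_act act upd M G) x r s v = map_option (Pair []) (ent (decode G r) s v)"
proof (induction s arbitrary: v rule: less_induct)
  case (less s)
  let ?b = "full_act act upd M G" and ?\<tau> = "decode G r"
  let ?msg = "\<lambda>u. setup_msg s (tk ?\<tau> u) (\<lambda>i. if i < s then ent ?\<tau> i u else None)"
  have hist: "nocd_hist E ?b x r s u = map (\<lambda>i. map_option (Pair []) (ent ?\<tau> i u)) [0..<s]" for u
    unfolding nocd_hist_eq_map using less by (intro map_cong) auto
  have past: "past (nocd_hist E ?b x r s u) = (\<lambda>i. if i < s then ent ?\<tau> i u else None)" for u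
    unfolding hist by (auto simp: past_def option.map_comp comp_def fun_eq_iff option.map_ident)
  have act: "?b (x u) (r u) (nocd_hist E ?b x r s u)
      = (if coin (tk ?\<tau> u) s then BTransmit ([], ?msg u) else BListen)" for u
    using less.prems past[of u] by (simp add: full_act_def sim_act_def setup_dec_def decode_def)
  show ?case
  proof (cases "\<exists>u. hears ?\<tau> s v u")
    case True
    then obtain u where u: "hears ?\<tau> s v u" by blast
    have "nocd_entry E ?b x r s v = Some ([], ?msg u)"
    proof (rule nocd_entry_SomeI)
      show "E v u" using u by (simp add: hears_def)
      show "?b (x v) (r v) (nocd_hist E ?b x r s v) = BListen"
        and "?b (x u) (r u) (nocd_hist E ?b x r s u) = BTransmit ([], ?msg u)"
        unfolding act using u by (simp_all add: hears_def)
      fix w m' assume w: "E v w" "?b (x w) (r w) (nocd_hist E ?b x r s w) = BTransmit m'"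
      from w(2) have "coin (tk ?\<tau> w) s" unfolding act by (simp split: if_splits)
      then show "w = u" using u w(1) by (auto simp: hears_def)
    qed
    then show ?thesis using ent_eq_Some[OF u] by simp
  next
    case False
    have "nocd_entry E ?b x r s v = None"
    proof (rule ccontr)
      assume "nocd_entry E ?b x r s v \<noteq> None"
      then have listen: "\<not> coin (tk ?\<tau> v) s" and ex1: "\<exists>!u. E v u \<and> coin (tk ?\<tau> u) s"
        unfolding nocd_entry_def Let_def act by (auto split: if_splits)
      from ex1 obtain u where "hears ?\<tau> s v u" using listen unfolding hears_def by blast
      then show False using False by blast
    qed
    then show ?thesis using ent_eq_None False by simp
  qed
qed

lemma past_setup:
  "past (nocd_hist E (full_act act upd M G) x r (4 * S) v)
    = (\<lambda>i. if i < 4 * S then ent (decode G r) i v else None)"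
  unfolding nocd_hist_eq_map
  by (auto simp: past_def fun_eq_iff nocd_entry_setup option.map_comp comp_def option.map_ident)

lemma own_colour_setup:
  "own_colour G (r v) (nocd_hist E (full_act act upd M G) x r (4 * S) v) = clr (decode G r) P v"
  unfolding own_colour_def past_setup
  by (subst colour_cong[of P _ "en (decode G r) v" _ "tk (decode G r) v"]) (simp_all add: decode_def cand_def)

lemma nbr_colours_setup:
  assumes "good (decode G r)"
  shows "nbr_colours (r v) (nocd_hist E (full_act act upd M G) x r (4 * S) v)
    = clr (decode G r) P ` {u. E v u}"
proof -
  have "heard (3 * S) (4 * S) (\<lambda>i. if i < 4 * S then ent (decode G r) i v else None)
      = heard (3 * S) (4 * S) (en (decode G r) v)"
    by (rule heard_cong) simp
  then show ?thesis
    unfolding nbr_colours_def past_setup using good_exchange[OF assms, of v] by simp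
qed

lemma good_simulation:
  assumes good: "good (decode G r)"
    and range: "\<And>v p. v \<in> V \<Longrightarrow> p < P \<Longrightarrow> decode G r (v, 4 * S + p) < M"
    and v: "v \<in> V"
  shows "sim_state upd (4 * S) M (x v) (nocd_hist E (full_act act upd M G) x r (4 * S + T * M) v) T
      = local_run E act upd x T v" (is ?out)
    and "local_energy E act upd x T v \<le> En \<Longrightarrow>
      nocd_energy E (full_act act upd M G) x r (4 * S + T * M) v \<le> 4 * S + En * (1 + card {u. E v u})"
      (is "_ \<Longrightarrow> ?energy")
proof -
  let ?h = "nocd_hist E (full_act act upd M G) x r"
  interpret tdma V E act upd "4 * S" M "setup_dec G" "own_colour G" nbr_colours x r
    "full_act act upd M G" ?h
    "\<lambda>v. own_colour G (r v) (?h (4 * S) v)" "\<lambda>v. nbr_colours (r v) (?h (4 * S) v)"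
  proof
    fix v assume v: "v \<in> V"
    show "own_colour G (r v) (?h (4 * S) v) < M"
      unfolding own_colour_setup using good_colour_less[OF good v] range[OF v] by blast
    show "own_colour G (r v) (?h (4 * S) v) \<notin> nbr_colours (r v) (?h (4 * S) v)"
      unfolding own_colour_setup nbr_colours_setup[OF good]
    proof
      assume "clr (decode G r) P v \<in> clr (decode G r) P ` {u. E v u}"
      then obtain u where "E v u" "clr (decode G r) P v = clr (decode G r) P u" by blast
      moreover have "v \<noteq> u" using \<open>E v u\<close> irrefl by blast
      ultimately show False using good_distinct[OF good, of v u] by blast
    qed
  next
    fix v u assume "E v u"
    then show "own_colour G (r u) (?h (4 * S) u) \<in> nbr_colours (r v) (?h (4 * S) v)"
      unfolding own_colour_setup nbr_colours_setup[OF good] by blast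
  next
    fix v u w assume "E v u" "E v w" "own_colour G (r u) (?h (4 * S) u) = own_colour G (r w) (?h (4 * S) w)"
    then show "u = w" unfolding own_colour_setup using good_distinct[OF good, of u w v] sym by blast
  qed (use fin E_V in \<open>auto simp: full_act_def\<close>)
  show ?out by (rule sim_state_eq_local_run[OF v])
  have finN: "finite {u. E v u}" by (rule finite_subset[OF _ fin]) (use E_V in auto)
  assume "local_energy E act upd x T v \<le> En"
  then have "nocd_energy E (full_act act upd M G) x r (4 * S + T * M) v
      \<le> 4 * S + En * (1 + card (nbr_colours (r v) (?h (4 * S) v)))"
    by (intro nocd_energy_le[OF v]) (simp_all add: nbr_colours_setup[OF good] finN)
  also have "\<dots> \<le> 4 * S + En * (1 + card {u. E v u})"
    unfolding nbr_colours_setup[OF good] by (intro add_left_mono mult_le_mono2 card_image_le finN)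
  finally show ?energy .
qed

end

section \<open>The simulation theorem\<close>

lemma is_graph_degree_le:
  assumes "is_graph V E"
  shows "card {u. E v u} \<le> max_deg V E"
proof (cases "v \<in> V")
  case True
  then show ?thesis using assms unfolding max_deg_def is_graph_def by (intro Max_ge) auto
next
  case False
  then have "{u. E v u} = {}" using assms by (auto simp: is_graph_def)
  then show ?thesis by simp
qed

text \<open>Two adjacent vertices of degree one form a set closed under adjacency, which by
  connectivity is all of \<open>V\<close>.\<close>

lemma max_deg_1_edge:
  assumes G: "is_graph V E" and deg: "max_deg V E = 1"
  obtains a b where "V = {a, b}" "a \<noteq> b"
proof -
  have fin: "finite V" "V \<noteq> {}" and sym: "\<And>u v. E u v \<Longrightarrow> E v u \<and> u \<in> V \<and> v \<in> V \<and> u \<noteq> v"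
    and conn: "\<And>u v. u \<in> V \<Longrightarrow> v \<in> V \<Longrightarrow> E\<^sup>*\<^sup>* u v"
    using G by (auto simp: is_graph_def)
  have "max_deg V E \<in> (\<lambda>v. card {u. E v u}) ` V"
    unfolding max_deg_def using fin by (intro Max_in) auto
  then obtain a where a: "a \<in> V" "card {u. E a u} = 1" using deg by auto
  then obtain b where b: "{u. E a u} = {b}" by (auto simp: card_1_singleton_iff)
  then have ab: "E a b" "\<And>u. E a u \<Longrightarrow> u = b" by auto
  have finb: "finite {u. E b u}" by (rule finite_subset[OF _ fin(1)]) (use sym in auto)
  have ba: "u = a" if "E b u" for u
  proof (rule ccontr)
    assume "u \<noteq> a"
    then have "card {a, u} = 2" by simp
    moreover have "card {a, u} \<le> card {u. E b u}"
      using finb that ab(1) sym by (intro card_mono) auto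
    ultimately show False using is_graph_degree_le[OF G, of b] deg by simp
  qed
  have "v = a \<or> v = b" if "v \<in> V" for v
    using conn[OF a(1) that] by (induction rule: rtranclp_induct) (use ab ba in blast)+
  then have "V = {a, b}" using a(1) sym[OF ab(1)] by auto
  then show ?thesis using that sym[OF ab(1)] by blast
qed

text \<open>With \<open>\<Delta> = 1\<close> the bounds leave no room for a setup, but the graph is a single edge, and a constant
  number of random bits breaks the symmetry with the required constant probability.\<close>

lemma single_edge_simulation:
  fixes V :: "'v set" and act :: "nat \<Rightarrow> 's \<Rightarrow> 'm option \<times> bool"
    and D :: "bool list \<Rightarrow> nat \<Rightarrow> nat"
  assumes G: "is_graph V E" "max_deg V E = 1"
    and dec: "bij_betw D {bs. length bs = 1 * m} ({..<1} \<rightarrow>\<^sub>E {..<2 ^ m})" "D [] = (\<lambda>_. undefined)"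
    and energy: "\<And>v. v \<in> V \<Longrightarrow> local_energy E act upd x T v \<le> En"
    and b: "b = sim_act act upd 0 (2 ^ m) (\<lambda>_ _. BIdle) (\<lambda>r _. D r 0) (\<lambda>r _. {..<2 ^ m} - {D r 0})"
  shows "real (card {r \<in> rand_assign V (1 * m). \<not> (\<forall>v\<in>V.
      sim_state upd 0 (2 ^ m) (x v) (nocd_hist E b x r (0 + T * 2 ^ m) v) T = local_run E act upd x T v \<and>
      nocd_energy E b x r (0 + T * 2 ^ m) v \<le> En * (1 + 2 ^ m))})
    \<le> real (card (rand_assign V (1 * m))) * (1 / 2 ^ m)"
proof -
  obtain a a' where V: "V = {a, a'}" "a \<noteq> a'" using max_deg_1_edge[OF G] .
  have E_V: "u \<in> V \<and> v \<in> V \<and> u \<noteq> v" if "E u v" for u v using that G by (auto simp: is_graph_def)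
  show ?thesis
  proof (rule card_bad_assign_le[OF dec, where B = "\<lambda>\<tau>. \<tau> (a, 0) = \<tau> (a', 0)"])
    show "avg (2 ^ m) (V \<times> {..<1::nat}) (\<lambda>\<tau>. of_bool (\<tau> (a, 0) = \<tau> (a', 0))) \<tau> \<le> 1 / 2 ^ m" for \<tau>
    proof (rule avg_le_superset)
      show "avg (2 ^ m) {(a, 0::nat)} (\<lambda>\<tau>. of_bool (\<tau> (a, 0) = \<tau> (a', 0))) \<tau> \<le> 1 / 2 ^ m" for \<tau>
        using avg_eq_token_le[of "(a', 0::nat)" "(a, 0)" "2 ^ m"] V by simp
    qed (use V in auto)
    fix r assume r: "r \<in> rand_assign V (1 * m)"
      and bad: "\<not> (\<forall>v\<in>V.
        sim_state upd 0 (2 ^ m) (x v) (nocd_hist E b x r (0 + T * 2 ^ m) v) T = local_run E act upd x T v \<and>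
        nocd_energy E b x r (0 + T * 2 ^ m) v \<le> En * (1 + 2 ^ m))"
    show "decode D r (a, 0) = decode D r (a', 0)"
    proof (rule ccontr)
      assume "decode D r (a, 0) \<noteq> decode D r (a', 0)"
      then have neq: "D (r u) 0 \<noteq> D (r v) 0" if "u \<in> V" "v \<in> V" "u \<noteq> v" for u v
        using that V by (auto simp: decode_def)
      have less: "D (r v) 0 < 2 ^ m" if "v \<in> V" for v
      proof -
        have "D (r v) \<in> {..<1} \<rightarrow>\<^sub>E {..<2 ^ m}"
          using bij_betwE[OF dec(1)] r that by (auto simp: rand_assign_def)
        then show ?thesis by (auto simp: PiE_iff)
      qed
      \<comment> \<open>There is no setup, so the colour of the neighbour is unknown and a vertex
        listens in every slot but its own. This is affordable because \<open>2 ^ m\<close> does not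
        depend on the graph.\<close>
      interpret tdma V E act upd 0 "2 ^ m" "\<lambda>_ _. BIdle" "\<lambda>r _. D r 0"
        "\<lambda>r _. {..<2 ^ m} - {D r 0}" x r b "nocd_hist E b x r" "\<lambda>v. D (r v) 0"
        "\<lambda>v. {..<2 ^ m} - {D (r v) 0}"
      proof
        fix u v assume uv: "E v u"
        then show "D (r u) 0 \<in> {..<2 ^ m} - {D (r v) 0}"
          using less neq[of u v] E_V[OF uv] by auto
        fix w assume "E v w"
        then show "u = w" using E_V[OF uv] E_V[of v w] V by auto
      qed (use b V less E_V in auto)
      have "nocd_energy E b x r (0 + T * 2 ^ m) v \<le> En * (1 + 2 ^ m)" if "v \<in> V" for v
      proof -
        have "card ({..<2 ^ m} - {D (r v) 0}) \<le> card {..<(2::nat) ^ m}" by (intro card_mono) auto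
        then have "En * (1 + card ({..<2 ^ m} - {D (r v) 0})) \<le> En * (1 + 2 ^ m)" by simp
        moreover have "nocd_energy E b x r (0 + T * 2 ^ m) v
            \<le> 0 + En * (1 + card ({..<2 ^ m} - {D (r v) 0}))"
          by (rule nocd_energy_le[OF that energy[OF that]]) simp
        ultimately show ?thesis by linarith
      qed
      then show False using bad sim_state_eq_local_run by blast
    qed
  qed (use V in auto)
qed

lemma (in random_network) random_simulation:
  fixes act :: "nat \<Rightarrow> 's \<Rightarrow> 'm option \<times> bool"
    and D :: "bool list \<Rightarrow> nat \<Rightarrow> nat"
  assumes dec: "bij_betw D {bs. length bs = (4 * S + P) * m} ({..<4 * S + P} \<rightarrow>\<^sub>E {..<2 ^ m})"
      "D [] = (\<lambda>_. undefined)"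
    and energy: "\<And>v. v \<in> V \<Longrightarrow> local_energy E act upd x T v \<le> En"
  shows "real (card {r \<in> rand_assign V ((4 * S + P) * m). \<not> (\<forall>v\<in>V.
      sim_state upd (4 * S) M (x v) (nocd_hist E (full_act act upd M D) x r (4 * S + T * M) v) T
        = local_run E act upd x T v \<and>
      nocd_energy E (full_act act upd M D) x r (4 * S + T * M) v \<le> 4 * S + En * (1 + \<Delta>))})
    \<le> real (card (rand_assign V ((4 * S + P) * m))) * (4 * real (card V) ^ 2 * (1 / 2) ^ P)"
proof (rule card_bad_assign_le[OF dec fin _ not_good_le])
  fix r assume r: "r \<in> rand_assign V ((4 * S + P) * m)"
    and bad: "\<not> (\<forall>v\<in>V.
      sim_state upd (4 * S) M (x v) (nocd_hist E (full_act act upd M D) x r (4 * S + T * M) v) T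
        = local_run E act upd x T v \<and>
      nocd_energy E (full_act act upd M D) x r (4 * S + T * M) v \<le> 4 * S + En * (1 + \<Delta>))"
  have range: "decode D r (v, 4 * S + p) < M" if "v \<in> V" "p < P" for v p
  proof -
    have "D (r v) \<in> {..<4 * S + P} \<rightarrow>\<^sub>E {..<M}"
      using bij_betwE[OF dec(1)] r that(1) by (auto simp: rand_assign_def)
    then show ?thesis using that(2) by (auto simp: PiE_iff decode_def)
  qed
  show "\<not> good (decode D r)"
  proof
    assume good: "good (decode D r)"
    have "nocd_energy E (full_act act upd M D) x r (4 * S + T * M) v \<le> 4 * S + En * (1 + \<Delta>)"
      if "v \<in> V" for v
    proof -
      have "En * (1 + card {u. E v u}) \<le> En * (1 + \<Delta>)" using degree[of v] by simp
      then show ?thesis using good_simulation(2)[OF good range that energy[OF that]] by linarith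
    qed
    then show False using bad good_simulation(1)[OF good range] by blast
  qed
qed simp

section \<open>Choice of parameters and final estimates\<close>

lemma ex_power_2_between:
  assumes "(\<Delta>::nat) \<ge> 2"
  obtains k where "\<Delta> \<le> 2 ^ k" "2 ^ k \<le> 2 * \<Delta>" "real k \<le> log 2 (real \<Delta>) + 1"
proof -
  obtain j where j: "2 ^ j < \<Delta>" "\<Delta> \<le> 2 ^ (j + 1)"
    using ex_power_ivl2[of 2 \<Delta>] assms by auto
  have "real j = log 2 (2 ^ j)" by simp
  also have "\<dots> \<le> log 2 (real \<Delta>)"
    using j(1) by (intro log_mono) (auto simp flip: of_nat_less_iff)
  finally show ?thesis using that[of "j + 1"] j by simp
qed

text \<open>In \<open>P\<close>, the factor \<open>c + 2\<close> pays for \<open>n powr c\<close>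
  and for the \<open>n ^ 2\<close> of the union bound, and the summand 2 for its factor 4. Rounding
  up adds at most 1 more, and \<open>log 2 (real n) \<ge> 1\<close> absorbs the total of 3 into
  \<open>c + 5\<close>.\<close>

lemma failure_le:
  fixes n P :: nat
  assumes "n \<ge> 2" "c > 0" "P = nat \<lceil>(c + 2) * log 2 (real n)\<rceil> + 2"
  shows "4 * real n ^ 2 * (1 / 2) ^ P \<le> 1 / real n powr c"
    and "real P \<le> (c + 5) * log 2 (real n)"
proof -
  have lg: "log 2 (real n) \<ge> 1" using assms(1) by (simp add: le_log_iff)
  have pos: "(c + 2) * log 2 (real n) \<ge> 0" using lg assms(2) by simp
  have P: "real P = of_int \<lceil>(c + 2) * log 2 (real n)\<rceil> + 2"
    using pos unfolding assms(3) by (simp add: of_nat_nat)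
  show "real P \<le> (c + 5) * log 2 (real n)"
  proof -
    have "real P \<le> (c + 2) * log 2 (real n) + 3" unfolding P by linarith
    then show ?thesis using lg by (simp add: algebra_simps)
  qed
  have "real n powr (c + 2) * 4 = 2 powr ((c + 2) * log 2 (real n) + 2)"
    using assms(1) by (simp add: powr_add powr_powr[symmetric] mult.commute[of "c + 2"])
  also have "\<dots> \<le> 2 powr real P" unfolding P by (intro powr_mono) (auto simp: le_of_int_ceiling)
  also have "\<dots> = 2 ^ P" by (simp add: powr_realpow)
  finally have "4 * (real n powr c * real n ^ 2) \<le> 2 ^ P"
    using assms(1) by (simp add: powr_add mult.commute flip: powr_numeral)
  then show "4 * real n ^ 2 * (1 / 2) ^ P \<le> 1 / real n powr c"
    using assms(1) by (simp add: field_simps power_one_over)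
qed

lemma finite_rand_assign:
  assumes "finite V"
  shows "finite (rand_assign V L)"
proof (rule finite_subset)
  show "rand_assign V L \<subseteq> {r. \<forall>v. (v \<in> V \<longrightarrow> r v \<in> {bs. set bs \<subseteq> UNIV \<and> length bs = L}) \<and>
      (v \<notin> V \<longrightarrow> r v = [])}"
    by (auto simp: rand_assign_def)
  show "finite \<dots>"
    by (intro finite_set_of_finite_funs assms finite_lists_length_eq) simp
qed

lemma card_bad_assign_mono:
  fixes \<delta> y :: real
  assumes "real (card {r \<in> rand_assign V L. \<not> Q r}) \<le> real (card (rand_assign V L)) * \<delta>"
    and "finite V" "\<delta> \<le> 1 / y" "\<And>r. Q r \<Longrightarrow> Q' r"
  shows "real (card {r \<in> rand_assign V L. \<not> Q' r}) \<le> real (card (rand_assign V L)) / y"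
proof -
  have "card {r \<in> rand_assign V L. \<not> Q' r} \<le> card {r \<in> rand_assign V L. \<not> Q r}"
    using finite_rand_assign[OF assms(2)] assms(4) by (intro card_mono) auto
  then have "real (card {r \<in> rand_assign V L. \<not> Q' r}) \<le> real (card (rand_assign V L)) * \<delta>"
    using assms(1) by linarith
  also have "\<dots> \<le> real (card (rand_assign V L)) * (1 / y)" by (intro mult_left_mono assms) simp
  finally show ?thesis by simp
qed

lemma max_deg_0_card:
  assumes G: "is_graph V E" and "max_deg V E = 0"
  shows "card V = 1"
proof -
  have fin: "finite V" "V \<noteq> {}" using G by (auto simp: is_graph_def)
  have no: "\<not> E u v" for u v
  proof -
    have "finite {v. E u v}" by (rule finite_subset[OF _ fin(1)]) (use G in \<open>auto simp: is_graph_def\<close>)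
    then show ?thesis using is_graph_degree_le[OF G, of u] assms(2) by auto
  qed
  have "u = v" if "u \<in> V" "v \<in> V" for u v
  proof -
    have "E\<^sup>*\<^sup>* u v" using G that by (auto simp: is_graph_def)
    then show ?thesis using no by (auto elim: converse_rtranclpE)
  qed
  moreover obtain v where "v \<in> V" using fin(2) by blast
  ultimately have "V = {v}" by blast
  then show ?thesis by simp
qed

theorem theorem3:
  fixes c :: real
  assumes "c > 0"
  shows "\<exists>C::real. C > 0 \<and>
    (\<forall>(n::nat) (\<Delta>::nat) (T::nat) (En::nat)
       (actA :: nat \<Rightarrow> 's \<Rightarrow> 'm option \<times> bool) (updA :: nat \<Rightarrow> 's \<Rightarrow> 'm multiset \<Rightarrow> 's).
     \<exists>(L::nat) (TB::nat)
       (actB :: 's \<Rightarrow> bool list \<Rightarrow> 'm sim_msg option list \<Rightarrow> 'm sim_msg actB)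
       (outB :: 's \<Rightarrow> bool list \<Rightarrow> 'm sim_msg option list \<Rightarrow> 's).
       real TB \<le> C * (real \<Delta> ^ 2 * real T + real \<Delta> * log 2 (real \<Delta>) * log 2 (real n)) \<and>
       (\<forall>(V::'v set) (E::'v \<Rightarrow> 'v \<Rightarrow> bool) (x::'v \<Rightarrow> 's).
          is_graph V E \<and> card V = n \<and> max_deg V E = \<Delta> \<and>
          (\<forall>v\<in>V. local_energy E actA updA x T v \<le> En) \<longrightarrow>
          real (card {r \<in> rand_assign V L.
                  \<not> (\<forall>v\<in>V. outB (x v) (r v) (nocd_hist E actB x r TB v) = local_run E actA updA x T v
                          \<and> real (nocd_energy E actB x r TB v)
                              \<le> C * real \<Delta> * (real En + log 2 (real \<Delta>) * log 2 (real n)))})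
            \<le> real (card (rand_assign V L)) / (real n powr c)))"
proof -
  \<comment> \<open>The number of random bits per vertex for a single edge: there
    \<open>n = 2\<close>, and equal colours have probability \<open>1 / 2 ^ m0\<close>, at most
    \<open>1 / 2 powr c\<close>.\<close>
  define m0 where "m0 = nat \<lceil>c\<rceil>"
  have m0: "m0 > 0" "c \<le> real m0" using assms by (auto simp: m0_def)
  \<comment> \<open>The setup has \<open>4 * S = 32 * \<Delta> * P * m\<close> slots, where
    \<open>m\<close> is at most \<open>7 * log 2 \<Delta>\<close> and \<open>P\<close> at most
    \<open>(c + 5) * log 2 n\<close>; this yields \<open>224 = 32 * 7\<close>. The palette needs 32,
    the single edge \<open>1 + 2 ^ m0\<close>.\<close>
  define C where "C = 224 * (c + 5) + 34 + 2 ^ m0"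
  have pow: "(2::real) ^ m0 > 0" by simp
  have C: "C \<ge> 224 * (c + 5)" "C \<ge> 32" "C \<ge> 1 + 2 ^ m0"
    using pow assms unfolding C_def by auto
  then have "C > 0" by linarith
  show ?thesis
  proof (intro exI[of _ C] conjI allI)
    show "C > 0" by fact
    fix n \<Delta> T En :: nat and actA :: "nat \<Rightarrow> 's \<Rightarrow> 'm option \<times> bool"
      and updA :: "nat \<Rightarrow> 's \<Rightarrow> 'm multiset \<Rightarrow> 's"
    let ?lg = "log 2 (real \<Delta>) * log 2 (real n)"
    consider (trivial) "n \<le> 1 \<or> \<Delta> = 0" | (edge) "n \<ge> 2" "\<Delta> = 1" | (main) "n \<ge> 2" "\<Delta> \<ge> 2" by linarith
    then show "\<exists>L TB (actB :: 's \<Rightarrow> bool list \<Rightarrow> 'm sim_msg option list \<Rightarrow> 'm sim_msg actB) outB.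
       real TB \<le> C * (real \<Delta> ^ 2 * real T + real \<Delta> * log 2 (real \<Delta>) * log 2 (real n)) \<and>
       (\<forall>(V::'v set) E x.
          is_graph V E \<and> card V = n \<and> max_deg V E = \<Delta> \<and>
          (\<forall>v\<in>V. local_energy E actA updA x T v \<le> En) \<longrightarrow>
          real (card {r \<in> rand_assign V L.
                  \<not> (\<forall>v\<in>V. outB (x v) (r v) (nocd_hist E actB x r TB v) = local_run E actA updA x T v
                          \<and> real (nocd_energy E actB x r TB v) \<le> C * real \<Delta> * (real En + ?lg))})
            \<le> real (card (rand_assign V L)) / (real n powr c))"
    proof cases
      case trivial
      show ?thesis
      proof (rule exI[of _ 0], rule exI[of _ 0], rule exI[of _ "\<lambda>_ _ _. BIdle"],
          rule exI[of _ "\<lambda>s _ _. s"], intro conjI allI impI)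
        have z: "real \<Delta> * log 2 (real \<Delta>) * log 2 (real n) = 0"
          \<comment> \<open>For \<open>n = 0\<close> this uses the default value
            \<open>ln 0 = 0\<close>.\<close>
          using trivial by (cases "n = 0 \<or> n = 1") (auto simp: log_def)
        show "real 0 \<le> C * (real \<Delta> ^ 2 * real T + real \<Delta> * log 2 (real \<Delta>) * log 2 (real n))"
          unfolding z using \<open>C > 0\<close> by simp
        fix V :: "'v set" and E x
        assume asm: "is_graph V E \<and> card V = n \<and> max_deg V E = \<Delta> \<and>
          (\<forall>v\<in>V. local_energy E actA updA x T v \<le> En)"
        then have fin: "finite V" "V \<noteq> {}" by (auto simp: is_graph_def)
        then have "n \<noteq> 0" using asm by auto
        then have "n = 1" using trivial asm max_deg_0_card[of V E] by auto
        then show "real (card {r \<in> rand_assign V 0.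
            \<not> (\<forall>v\<in>V. x v = local_run E actA updA x T v \<and>
              real (nocd_energy E (\<lambda>_ _ _. BIdle :: 'm sim_msg actB) x r 0 v) \<le> C * real \<Delta> * (real En + ?lg))})
            \<le> real (card (rand_assign V 0)) / (real n powr c)"
          using finite_rand_assign[OF fin(1)] by (auto intro!: card_mono)
      qed
    next
      case edge
      have "1 * m0 > 0" using m0(1) by simp
      then obtain D :: "bool list \<Rightarrow> nat \<Rightarrow> nat"
        where D: "bij_betw D {bs. length bs = 1 * m0} ({..<1} \<rightarrow>\<^sub>E {..<2 ^ m0})" "D [] = (\<lambda>_. undefined)"
        by (rule ex_decoder)
      define b :: "'s \<Rightarrow> bool list \<Rightarrow> 'm sim_msg option list \<Rightarrow> 'm sim_msg actB" where
        "b = sim_act actA updA 0 (2 ^ m0) (\<lambda>_ _. BIdle) (\<lambda>r _. D r 0) (\<lambda>r _. {..<2 ^ m0} - {D r 0})"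
      show ?thesis
      proof (rule exI[of _ "1 * m0"], rule exI[of _ "0 + T * 2 ^ m0"], rule exI[of _ b],
          rule exI[of _ "\<lambda>s r h. sim_state updA 0 (2 ^ m0) s h T"], intro conjI allI impI)
        have "real T * 2 ^ m0 \<le> real T * C" using C(3) by (intro mult_left_mono) auto
        then show "real (0 + T * 2 ^ m0)
            \<le> C * (real \<Delta> ^ 2 * real T + real \<Delta> * log 2 (real \<Delta>) * log 2 (real n))"
          using edge by (simp add: mult.commute)
        fix V :: "'v set" and E x
        assume asm: "is_graph V E \<and> card V = n \<and> max_deg V E = \<Delta> \<and>
          (\<forall>v\<in>V. local_energy E actA updA x T v \<le> En)"
        have G: "is_graph V E" "max_deg V E = 1" using asm edge by auto
        obtain a a' where "V = {a, a'}" "a \<noteq> a'" using max_deg_1_edge[OF G] .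
        then have n: "n = 2" using asm by auto
        show "real (card {r \<in> rand_assign V (1 * m0).
            \<not> (\<forall>v\<in>V. sim_state updA 0 (2 ^ m0) (x v) (nocd_hist E b x r (0 + T * 2 ^ m0) v) T
                = local_run E actA updA x T v \<and>
              real (nocd_energy E b x r (0 + T * 2 ^ m0) v) \<le> C * real \<Delta> * (real En + ?lg))})
            \<le> real (card (rand_assign V (1 * m0))) / (real n powr c)"
        proof (rule card_bad_assign_mono[OF single_edge_simulation[OF G D _ b_def]])
          show "local_energy E actA updA x T v \<le> En" if "v \<in> V" for v using asm that by blast
          show "finite V" using G by (simp add: is_graph_def)
          have "2 powr c \<le> 2 powr real m0" using m0(2) by (intro powr_mono) auto
          then have "2 powr c \<le> (2::real) ^ m0" by (simp add: powr_realpow)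
          then show "1 / 2 ^ m0 \<le> 1 / (real n powr c)" using n by (simp add: frac_le)
          fix r
          assume Q: "\<forall>v\<in>V. sim_state updA 0 (2 ^ m0) (x v) (nocd_hist E b x r (0 + T * 2 ^ m0) v) T
                = local_run E actA updA x T v \<and>
              nocd_energy E b x r (0 + T * 2 ^ m0) v \<le> En * (1 + 2 ^ m0)"
          have "real (nocd_energy E b x r (0 + T * 2 ^ m0) v) \<le> C * real \<Delta> * (real En + ?lg)"
            if "v \<in> V" for v
          proof -
            have "real (nocd_energy E b x r (0 + T * 2 ^ m0) v) \<le> real (En * (1 + 2 ^ m0))"
              using Q that by (intro of_nat_mono) blast
            also have "\<dots> = real En * (1 + 2 ^ m0)" by (simp add: distrib_left)
            also have "\<dots> \<le> real En * C" by (intro mult_left_mono C(3)) simp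
            finally show ?thesis using edge by (simp add: mult.commute)
          qed
          then show "\<forall>v\<in>V. sim_state updA 0 (2 ^ m0) (x v) (nocd_hist E b x r (0 + T * 2 ^ m0) v) T
                = local_run E actA updA x T v \<and>
              real (nocd_energy E b x r (0 + T * 2 ^ m0) v) \<le> C * real \<Delta> * (real En + ?lg)"
            using Q by blast
        qed
      qed
    next
      case main
      obtain k where k: "\<Delta> \<le> 2 ^ k" "2 ^ k \<le> 2 * \<Delta>" "real k \<le> log 2 (real \<Delta>) + 1"
        using ex_power_2_between[OF main(2)] .
      define m where "m = 2 * k + 3"
      define l where "l = 8 * \<Delta> * m"
      define P where "P = nat \<lceil>(c + 2) * log 2 (real n)\<rceil> + 2"
      note P = failure_le[OF main(1) assms P_def]
      \<comment> \<open>The algorithm may depend on \<open>n\<close> and \<open>\<Delta>\<close> but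
        must be fixed before the graph is given, so only the parameters are interpreted here;
        \<open>random_network\<close> has to wait until \<open>V\<close> and \<open>E\<close> are
        known.\<close>
      interpret setup_params k l P .
      have "(4 * S + P) * m > 0" by (simp add: m_def P_def)
      then obtain D :: "bool list \<Rightarrow> nat \<Rightarrow> nat"
        where D: "bij_betw D {bs. length bs = (4 * S + P) * m} ({..<4 * S + P} \<rightarrow>\<^sub>E {..<2 ^ m})"
          "D [] = (\<lambda>_. undefined)"
        by (rule ex_decoder)
      define b :: "'s \<Rightarrow> bool list \<Rightarrow> 'm sim_msg option list \<Rightarrow> 'm sim_msg actB" where
        "b = full_act actA updA (2 ^ m) D"
      have lg\<Delta>: "log 2 (real \<Delta>) \<ge> 1" and lgn: "log 2 (real n) \<ge> 1"
        using main by (simp_all add: le_log_iff)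
      have setup_le: "real (4 * S) \<le> 224 * (c + 5) * (real \<Delta> * ?lg)"
      proof -
        have "real m \<le> 7 * log 2 (real \<Delta>)" using k(3) lg\<Delta> by (simp add: m_def)
        then have "real P * real m \<le> ((c + 5) * log 2 (real n)) * (7 * log 2 (real \<Delta>))"
          using P(2) lgn assms by (intro mult_mono) auto
        then have "32 * real \<Delta> * (real P * real m)
            \<le> 32 * real \<Delta> * (((c + 5) * log 2 (real n)) * (7 * log 2 (real \<Delta>)))"
          by (rule mult_left_mono) simp
        moreover have "real (4 * S) = 32 * real \<Delta> * (real P * real m)" unfolding S_def by (simp add: l_def)
        ultimately show ?thesis by (simp add: algebra_simps)
      qed
      have lg_nonneg: "real \<Delta> * ?lg \<ge> 0" using lg\<Delta> lgn by simp
      \<comment> \<open>The upper bound \<open>2 ^ k \<le> 2 * \<Delta>\<close> turns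
        \<open>8 * (2 ^ k) ^ 2\<close> into \<open>8 * 4 * \<Delta> ^ 2\<close>.\<close>
      have slot_le: "(2::real) ^ m \<le> 32 * real \<Delta> ^ 2"
      proof -
        have "real (2 ^ k) \<le> real (2 * \<Delta>)" using k(2) by (rule of_nat_mono)
        then have "(2 ^ k) ^ 2 \<le> (2 * real \<Delta>) ^ 2" by (intro power_mono) auto
        moreover have "(2::real) ^ m = 8 * (2 ^ k) ^ 2"
          unfolding m_def by (simp add: power_add power_mult mult.commute)
        ultimately show ?thesis by (simp add: power_mult_distrib)
      qed
      show ?thesis
      proof (rule exI[of _ "(4 * S + P) * m"], rule exI[of _ "4 * S + T * 2 ^ m"], rule exI[of _ b],
          rule exI[of _ "\<lambda>s r h. sim_state updA (4 * S) (2 ^ m) s h T"], intro conjI allI impI)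
        have "real (4 * S + T * 2 ^ m) = real (4 * S) + real T * 2 ^ m" by simp
        also have "\<dots> \<le> C * (real \<Delta> * ?lg) + real T * (C * real \<Delta> ^ 2)"
        proof (intro add_mono mult_left_mono)
          have "224 * (c + 5) * (real \<Delta> * ?lg) \<le> C * (real \<Delta> * ?lg)"
            by (intro mult_right_mono C(1) lg_nonneg)
          then show "real (4 * S) \<le> C * (real \<Delta> * ?lg)" using setup_le by linarith
          have "32 * real \<Delta> ^ 2 \<le> C * real \<Delta> ^ 2" by (intro mult_right_mono C(2)) simp
          then show "2 ^ m \<le> C * real \<Delta> ^ 2" using slot_le by linarith
        qed simp
        finally show "real (4 * S + T * 2 ^ m)
            \<le> C * (real \<Delta> ^ 2 * real T + real \<Delta> * log 2 (real \<Delta>) * log 2 (real n))"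
          by (simp add: algebra_simps)
        fix V :: "'v set" and E x
        assume asm: "is_graph V E \<and> card V = n \<and> max_deg V E = \<Delta> \<and>
          (\<forall>v\<in>V. local_energy E actA updA x T v \<le> En)"
        then have G: "is_graph V E" by blast
        interpret random_network k l P V E \<Delta> m
          by unfold_locales
            (use G asm is_graph_degree_le[OF G] main k in \<open>auto simp: is_graph_def m_def l_def\<close>)
        show "real (card {r \<in> rand_assign V ((4 * S + P) * m).
            \<not> (\<forall>v\<in>V. sim_state updA (4 * S) (2 ^ m) (x v) (nocd_hist E b x r (4 * S + T * 2 ^ m) v) T
                = local_run E actA updA x T v \<and>
              real (nocd_energy E b x r (4 * S + T * 2 ^ m) v) \<le> C * real \<Delta> * (real En + ?lg))})
            \<le> real (card (rand_assign V ((4 * S + P) * m))) / (real n powr c)"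
        proof (rule card_bad_assign_mono[OF random_simulation
              [where act = actA and upd = updA and x = x and T = T and En = En, OF D, folded b_def]])
          show "local_energy E actA updA x T v \<le> En" if "v \<in> V" for v using asm that by blast
          show "finite V" by (rule fin)
          show "4 * real (card V) ^ 2 * (1 / 2) ^ P \<le> 1 / (real n powr c)" using P(1) asm by simp
          fix r
          assume Q: "\<forall>v\<in>V. sim_state updA (4 * S) (2 ^ m) (x v) (nocd_hist E b x r (4 * S + T * 2 ^ m) v) T
                = local_run E actA updA x T v \<and>
              nocd_energy E b x r (4 * S + T * 2 ^ m) v \<le> 4 * S + En * (1 + \<Delta>)"
          have "real (nocd_energy E b x r (4 * S + T * 2 ^ m) v) \<le> C * real \<Delta> * (real En + ?lg)"
            if "v \<in> V" for v
          proof -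
            have "real (nocd_energy E b x r (4 * S + T * 2 ^ m) v) \<le> real (4 * S + En * (1 + \<Delta>))"
              using Q that by (intro of_nat_mono) blast
            also have "\<dots> = real (4 * S) + real En * (1 + real \<Delta>)" by (simp add: distrib_left)
            also have "\<dots> \<le> C * (real \<Delta> * ?lg) + real En * (C * real \<Delta>)"
            proof (intro add_mono mult_left_mono)
              have "224 * (c + 5) * (real \<Delta> * ?lg) \<le> C * (real \<Delta> * ?lg)"
                by (intro mult_right_mono C(1) lg_nonneg)
              then show "real (4 * S) \<le> C * (real \<Delta> * ?lg)" using setup_le by linarith
              have "32 * real \<Delta> \<le> C * real \<Delta>" by (intro mult_right_mono C(2)) simp
              then show "1 + real \<Delta> \<le> C * real \<Delta>" using main(2) by linarith
            qed simp
            finally show ?thesis by (simp add: algebra_simps)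
          qed
          then show "\<forall>v\<in>V. sim_state updA (4 * S) (2 ^ m) (x v) (nocd_hist E b x r (4 * S + T * 2 ^ m) v) T
                = local_run E actA updA x T v \<and>
              real (nocd_energy E b x r (4 * S + T * 2 ^ m) v) \<le> C * real \<Delta> * (real En + ?lg)"
            using Q by blast
        qed
      qed
    qed
  qed
qed

end
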